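(* If there exists an algorithm that decides the Subset Sum problem in $\mathcal{O}^*(t(n))$ time and $\mathcal{O}^*(s(n))$ space, then there exists an algorithm that decides the Knapsack problem in $\mathcal{O}^*(t(n))$ time and $\mathcal{O}^*(s(n))$ space.
   Context: Subset Sum: given a set $U=\{1,\ldots,n\}$, a weight function $\omega : U \rightarrow \{1,\ldots,N\}$, and an integer $t \leq N$, decide whether there exists $X \subseteq U$ with $\omega(X)=t$. Knapsack: given $U=\{1,\ldots,n\}$, weight functions $\omega,\nu : U \rightarrow \{1,\ldots,N\}$ and integers $t,b$, decide whether there exists $X \subseteq U$ with $\nu(X) \leq b$ and $\omega(X) \geq t$. Here $\omega(X)=\sum_{e\in X}\omega(e)$, $n=|U|$ is the number of items, and $\mathcal{O}^*(\cdot)$ suppresses factors polynomial in the input size of the given instance (integers encoded in binary). *)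

theory Defs
  imports Complex_Main "HOL-Library.Log_Nat" "HOL-Computational_Algebra.Polynomial"
begin

section \<open>Random access machine with logarithmic cost\<close>

text \<open>
  The machine has integer registers, which a program names directly, and an integer memory, which
  is only reached through addresses held in registers. Control flow is structured; this costs at
  most a constant factor (depending on the program) compared with jumps. Integers are unbounded,
  and every step is charged the number of bits of the integers it handles.
\<close>

record state =
  regs :: "nat \<Rightarrow> int"
  mem :: "int \<Rightarrow> int"

datatype arith = Plus | Minus | Times | Div

datatype instr =
    Const nat int
  | Arith nat arith nat nat
  | Load nat nat
  | Store nat nat

datatype com =
    Skip
  | Do instr
  | Seq com com
  | Cond nat com com
  | Loop nat com

definition bits :: "int \<Rightarrow> nat" where
  "bits z = max 1 (floorlog 2 (nat \<bar>z\<bar>))"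

fun arith_op :: "arith \<Rightarrow> int \<Rightarrow> int \<Rightarrow> int" where
  "arith_op Plus x y = x + y"
| "arith_op Minus x y = x - y"
| "arith_op Times x y = x * y"
| "arith_op Div x y = x div y"

text \<open>
  \<open>Load r a\<close> reads into register \<open>r\<close> the memory cell addressed by the content of register \<open>a\<close>;
  \<open>Store a r\<close> writes the content of register \<open>r\<close> to that cell.
\<close>

fun instr_result :: "instr \<Rightarrow> state \<Rightarrow> state" where
  "instr_result (Const r z) s = s\<lparr>regs := (regs s)(r := z)\<rparr>"
| "instr_result (Arith r f a b) s =
     s\<lparr>regs := (regs s)(r := arith_op f (regs s a) (regs s b))\<rparr>"
| "instr_result (Load r a) s = s\<lparr>regs := (regs s)(r := mem s (regs s a))\<rparr>"
| "instr_result (Store a r) s = s\<lparr>mem := (mem s)(regs s a := regs s r)\<rparr>"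

fun instr_cost :: "instr \<Rightarrow> state \<Rightarrow> nat" where
  "instr_cost (Const r z) s = bits z"
| "instr_cost (Arith r f a b) s = bits (regs s a) + bits (regs s b)"
| "instr_cost (Load r a) s = bits (regs s a) + bits (mem s (regs s a))"
| "instr_cost (Store a r) s = bits (regs s a) + bits (regs s r)"

text \<open>
  A nonzero memory cell is charged for its content and for its address, so that information cannot
  be hidden in the choice of the cells in use. Both sums range over finite sets in all states that
  are reachable from an input, see \<open>exec_finite_support\<close> below.
\<close>

definition state_size :: "state \<Rightarrow> nat" where
  "state_size s =
     (\<Sum>r | regs s r \<noteq> 0. bits (regs s r)) + (\<Sum>a | mem s a \<noteq> 0. bits a + bits (mem s a))"

text \<open>
  \<open>exec c s \<tau> \<sigma> s'\<close>: started in \<open>s\<close>, the program \<open>c\<close> halts in \<open>s'\<close>, its running time is \<open>\<tau>\<close>, and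
  \<open>\<sigma>\<close> is the maximal size of a state that occurs in the run. Tests ask whether a register is
  positive.
\<close>

inductive exec :: "com \<Rightarrow> state \<Rightarrow> nat \<Rightarrow> nat \<Rightarrow> state \<Rightarrow> bool" where
  Skip: "exec Skip s 1 (state_size s) s"
| Do: "exec (Do i) s (instr_cost i s)
         (max (state_size s) (state_size (instr_result i s))) (instr_result i s)"
| Seq: "exec c1 s \<tau>1 \<sigma>1 s1 \<Longrightarrow> exec c2 s1 \<tau>2 \<sigma>2 s2 \<Longrightarrow>
        exec (Seq c1 c2) s (\<tau>1 + \<tau>2) (max \<sigma>1 \<sigma>2) s2"
| CondTrue: "regs s r > 0 \<Longrightarrow> exec c1 s \<tau> \<sigma> s' \<Longrightarrow>
        exec (Cond r c1 c2) s (bits (regs s r) + \<tau>) \<sigma> s'"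
| CondFalse: "\<not> regs s r > 0 \<Longrightarrow> exec c2 s \<tau> \<sigma> s' \<Longrightarrow>
        exec (Cond r c1 c2) s (bits (regs s r) + \<tau>) \<sigma> s'"
| LoopFalse: "\<not> regs s r > 0 \<Longrightarrow>
        exec (Loop r c) s (bits (regs s r)) (state_size s) s"
| LoopTrue: "regs s r > 0 \<Longrightarrow> exec c s \<tau>1 \<sigma>1 s1 \<Longrightarrow> exec (Loop r c) s1 \<tau>2 \<sigma>2 s2 \<Longrightarrow>
        exec (Loop r c) s (bits (regs s r) + \<tau>1 + \<tau>2) (max \<sigma>1 \<sigma>2) s2"

inductive_cases exec_SkipE: "exec Skip s \<tau> \<sigma> s'"
inductive_cases exec_DoE: "exec (Do i) s \<tau> \<sigma> s'"
inductive_cases exec_SeqE: "exec (Seq c1 c2) s \<tau> \<sigma> s'"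
inductive_cases exec_CondE: "exec (Cond r c1 c2) s \<tau> \<sigma> s'"
inductive_cases exec_LoopE: "exec (Loop r c) s \<tau> \<sigma> s'"

lemma exec_deterministic:
  "exec c s \<tau> \<sigma> s' \<Longrightarrow> exec c s \<tau>' \<sigma>' s'' \<Longrightarrow> \<tau>' = \<tau> \<and> \<sigma>' = \<sigma> \<and> s'' = s'"
proof (induction arbitrary: \<tau>' \<sigma>' s'' rule: exec.induct)
  case (Skip s) then show ?case by (auto elim: exec_SkipE)
next
  case (Do i s) then show ?case by (auto elim: exec_DoE)
next
  case (Seq c1 s \<tau>1 \<sigma>1 s1 c2 \<tau>2 \<sigma>2 s2)
  from Seq.prems show ?case by (rule exec_SeqE) (use Seq.IH in blast)
next
  case (CondTrue s r c1 \<tau> \<sigma> s' c2)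
  from CondTrue.prems show ?case by (rule exec_CondE) (use CondTrue in blast)+
next
  case (CondFalse s r c2 \<tau> \<sigma> s' c1)
  from CondFalse.prems show ?case by (rule exec_CondE) (use CondFalse in blast)+
next
  case (LoopFalse s r c)
  from LoopFalse.prems show ?case by (rule exec_LoopE) (use LoopFalse in auto)
next
  case (LoopTrue s r c \<tau>1 \<sigma>1 s1 \<tau>2 \<sigma>2 s2)
  from LoopTrue.prems show ?case by (rule exec_LoopE) (use LoopTrue in blast)+
qed

definition finite_support :: "state \<Rightarrow> bool" where
  "finite_support s \<longleftrightarrow> finite {r. regs s r \<noteq> 0} \<and> finite {a. mem s a \<noteq> 0}"

lemma finite_upd_support: "finite {x. f x \<noteq> 0} \<Longrightarrow> finite {x. (f(y := z)) x \<noteq> (0::int)}"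
  by (rule finite_subset[of _ "insert y {x. f x \<noteq> 0}"]) auto

lemma instr_finite_support: "finite_support s \<Longrightarrow> finite_support (instr_result i s)"
  unfolding finite_support_def
  by (cases i) (simp_all add: finite_upd_support del: fun_upd_apply)

lemma exec_finite_support: "exec c s \<tau> \<sigma> s' \<Longrightarrow> finite_support s \<Longrightarrow> finite_support s'"
  by (induction rule: exec.induct) (auto simp: instr_finite_support)

text \<open>The input occupies the memory cells from address 0 on; everything else is initially 0.\<close>

definition init :: "int list \<Rightarrow> state" where
  "init xs = \<lparr>regs = (\<lambda>_. 0),
              mem = (\<lambda>a. if 0 \<le> a \<and> a < int (length xs) then xs ! nat a else 0)\<rparr>"

lemma init_finite_support: "finite_support (init xs)"
proof -
  have "{a. mem (init xs) a \<noteq> 0} \<subseteq> {0..<int (length xs)}"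
    by (auto simp: init_def split: if_splits)
  then have "finite {a. mem (init xs) a \<noteq> 0}"
    by (rule finite_subset) simp
  then show ?thesis by (simp add: finite_support_def init_def)
qed


section \<open>Decision problems and the O-star notation\<close>

record 'i problem =
  instances :: "'i set"
  accepted :: "'i \<Rightarrow> bool"
  encoding :: "'i \<Rightarrow> int list"
  num_items :: "'i \<Rightarrow> nat"

definition input_size :: "'i problem \<Rightarrow> 'i \<Rightarrow> nat" where
  "input_size \<Pi> I = (\<Sum>x\<leftarrow>encoding \<Pi> I. bits x)"

definition decides :: "com \<Rightarrow> 'i problem \<Rightarrow> bool" where
  "decides P \<Pi> \<longleftrightarrow> (\<forall>I \<in> instances \<Pi>. \<exists>\<tau> \<sigma> s.
     exec P (init (encoding \<Pi> I)) \<tau> \<sigma> s \<and> regs s 0 = (if accepted \<Pi> I then 1 else 0))"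

text \<open>
  The polynomial has natural coefficients, so the suppressed factor is nonnegative; bounding by
  all real polynomials that are nonnegative on the naturals would give the same notion. No claim
  is made about inputs that do not encode an instance.
\<close>

definition O_star_time :: "com \<Rightarrow> 'i problem \<Rightarrow> (nat \<Rightarrow> real) \<Rightarrow> bool" where
  "O_star_time P \<Pi> f \<longleftrightarrow> (\<exists>p :: nat poly. \<forall>I \<in> instances \<Pi>. \<forall>\<tau> \<sigma> s.
     exec P (init (encoding \<Pi> I)) \<tau> \<sigma> s \<longrightarrow>
     real \<tau> \<le> real (poly p (input_size \<Pi> I)) * f (num_items \<Pi> I))"

definition O_star_space :: "com \<Rightarrow> 'i problem \<Rightarrow> (nat \<Rightarrow> real) \<Rightarrow> bool" where
  "O_star_space P \<Pi> f \<longleftrightarrow> (\<exists>p :: nat poly. \<forall>I \<in> instances \<Pi>. \<forall>\<tau> \<sigma> s.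
     exec P (init (encoding \<Pi> I)) \<tau> \<sigma> s \<longrightarrow>
     real \<sigma> \<le> real (poly p (input_size \<Pi> I)) * f (num_items \<Pi> I))"


section \<open>Subset Sum and Knapsack\<close>

text \<open>
  The universe is \<open>{1..n}\<close>; the values of weight functions outside of it are irrelevant. The upper
  bound \<open>N\<close> on the weights is part of an instance.
\<close>

record subset_sum_instance =
  ss_n :: nat
  ss_N :: nat
  ss_weight :: "nat \<Rightarrow> nat"
  ss_t :: int

definition subset_sum :: "subset_sum_instance problem" where
  "subset_sum = \<lparr>
     instances = {I. ss_weight I ` {1..ss_n I} \<subseteq> {1..ss_N I} \<and> ss_t I \<le> int (ss_N I)},
     accepted = (\<lambda>I. \<exists>X \<subseteq> {1..ss_n I}. int (\<Sum>e\<in>X. ss_weight I e) = ss_t I),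
     encoding = (\<lambda>I. [int (ss_n I), int (ss_N I)]
                     @ map (\<lambda>e. int (ss_weight I e)) [1..<Suc (ss_n I)] @ [ss_t I]),
     num_items = ss_n\<rparr>"

record knapsack_instance =
  ks_n :: nat
  ks_N :: nat
  ks_omega :: "nat \<Rightarrow> nat"
  ks_nu :: "nat \<Rightarrow> nat"
  ks_t :: int
  ks_b :: int

definition knapsack :: "knapsack_instance problem" where
  "knapsack = \<lparr>
     instances = {I. ks_omega I ` {1..ks_n I} \<subseteq> {1..ks_N I} \<and> ks_nu I ` {1..ks_n I} \<subseteq> {1..ks_N I}},
     accepted = (\<lambda>I. \<exists>X \<subseteq> {1..ks_n I}.
        int (\<Sum>e\<in>X. ks_nu I e) \<le> ks_b I \<and> int (\<Sum>e\<in>X. ks_omega I e) \<ge> ks_t I),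
     encoding = (\<lambda>I. [int (ks_n I), int (ks_N I)]
                     @ map (\<lambda>e. int (ks_omega I e)) [1..<Suc (ks_n I)]
                     @ map (\<lambda>e. int (ks_nu I e)) [1..<Suc (ks_n I)] @ [ks_t I, ks_b I]),
     num_items = ks_n\<rparr>"

end

(* Scaling by a power of 2 turns an inequality into few equations. For t > 0 let k be maximal such
   that the sum of the rounded down weights w(e) div 2^k is still at least t / 2^k. By maximality that
   sum lies among the first n integers from t / 2^k on. Rounding up instead of down treats the
   upper bound b on the second weight function in the same way. A pair of equations is one equation
   for the weights w' * Q + v' with large Q, and rounding up keeps them positive. So Knapsack
   reduces to polynomially many Subset Sum instances on the same items.
   The composed program gives each of these runs its own residue class of the memory addresses. *)

theory Submission
  imports Defs
begin

text \<open>The bounding functions are arbitrary, possibly not monotone, so every query must have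
  exactly \<open>n\<close> items. Extra items that represent the slack of an inequality are
  therefore ruled out, and the slack itself has to become small: coarsening the scale by a factor 2
  loses at most one unit per item, so where the comparison changes its outcome the rounded sum is
  within \<open>n\<close> of the threshold. On the machine the Subset Sum program is a black box.
  The registers it can write are visible in its text, but the memory cells depend on the run, so no
  fixed piece of code resets them; this is why each run gets fresh cells. The last obstacle is the
  additive overhead: it must fit below a polynomial times a function value that may be smaller than
  1.\<close>

section \<open>Time and growth of programs\<close>

lemma bits_pos: "1 \<le> bits z"
  by (simp add: bits_def)

lemma bits_le_iff: "0 < k \<Longrightarrow> bits z \<le> k \<longleftrightarrow> \<bar>z\<bar> < 2 ^ k"
proof -
  assume k: "0 < k"
  have "floorlog 2 (nat \<bar>z\<bar>) \<le> k \<longleftrightarrow> nat \<bar>z\<bar> < 2 ^ k"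
    by (simp add: floorlog_le_iff)
  also have "\<dots> \<longleftrightarrow> \<bar>z\<bar> < 2 ^ k"
    by (simp add: nat_less_iff)
  finally show ?thesis using k by (simp add: bits_def)
qed

lemma abs_less_bits: "\<bar>z\<bar> < 2 ^ bits z"
  using bits_le_iff[of "bits z" z] bits_pos[of z] by simp

lemma bits_mono: "\<bar>x\<bar> \<le> \<bar>y\<bar> \<Longrightarrow> bits x \<le> bits y"
  using bits_le_iff[of "bits y" x] bits_pos[of y] abs_less_bits[of y] by simp

lemma bits_minus [simp]: "bits (- x) = bits x"
  by (simp add: bits_def)

lemma bits_add: "bits (x + y) \<le> bits x + bits y"
proof -
  have two: "(2::int) \<le> 2 ^ bits z" for z
    using power_increasing[OF bits_pos, of "2::int" z] by simp
  \<comment> \<open>Expanded, the right-hand side is the product of the two powers minus their sum.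
    Both powers are at least 2 because even 0 has bit length 1.\<close>
  have "(0::int) \<le> (2 ^ bits x - 2) * (2 ^ bits y - 1) + (2 ^ bits y - 2)"
    using two[of x] two[of y] by (intro add_nonneg_nonneg mult_nonneg_nonneg) auto
  then have "(2::int) ^ bits x + 2 ^ bits y \<le> 2 ^ bits x * 2 ^ bits y"
    by (simp add: algebra_simps)
  moreover have "\<bar>x + y\<bar> < 2 ^ bits x + 2 ^ bits y"
    using abs_less_bits[of x] abs_less_bits[of y] by linarith
  ultimately show ?thesis
    using bits_pos[of x] by (simp add: bits_le_iff power_add)
qed

lemma bits_diff: "bits (x - y) \<le> bits x + bits y"
  using bits_add[of x "- y"] by simp

lemma bits_mult: "bits (x * y) \<le> bits x + bits y"
  using bits_pos[of x]
  by (simp add: bits_le_iff abs_mult power_add mult_strict_mono' abs_less_bits)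

lemma bits_div: "bits (x div y) \<le> bits x"
proof (rule bits_mono)
  show "\<bar>x div y\<bar> \<le> \<bar>x\<bar>"
  proof (cases "y = 0")
    case False
    have *: "\<bar>x div y\<bar> \<le> \<bar>x\<bar>" if "0 < y" for x y :: int
    proof (cases "0 \<le> x")
      case True
      then have "x div y \<le> x div 1"
        using True that by (intro zdiv_mono2) auto
      then have "x div y \<le> x" "0 \<le> x div y"
        using that True by (simp_all add: pos_imp_zdiv_nonneg_iff)
      then show ?thesis using True by simp
    next
      case False
      have "x div y < 0" "x * y \<le> x" 
        using False that by (simp_all add: pos_imp_zdiv_neg_iff mult_le_cancel_left1)
      \<comment> \<open>A negative quotient is rounded away from zero; comparing \<open>x\<close>
        with the smaller \<open>x * y\<close> still gives \<open>x \<le> x div y\<close>.\<close>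
      moreover have "x div y \<ge> (x * y) div y"
        using zdiv_mono1[OF \<open>x * y \<le> x\<close> that] .
      ultimately show ?thesis using that by simp
    qed
    show ?thesis
      using *[of y x] *[of "- y" "- x"] False by (cases "0 < y") auto
  qed simp
qed

lemma bits_le_bound: "0 \<le> x \<Longrightarrow> x < int k \<Longrightarrow> bits x \<le> k"
proof -
  assume x: "0 \<le> x" "x < int k"
  then have "\<bar>x\<bar> < 2 ^ k" using of_nat_less_two_power[of k, where 'a = int] by linarith
  then show ?thesis using x by (subst bits_le_iff) auto
qed

lemma bits_small [simp]: "bits 0 = 1" "bits 1 = 1"
  by (simp_all add: bits_def floorlog_def)

text \<open>Rules for computing \<open>i\<close> in a goal \<open>p \<le> ?i * L\<close>.\<close>

lemma linear_bounds:
  assumes "1 \<le> L"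
  shows "bits 0 \<le> 1 * L" "bits 1 \<le> 1 * L" "bits (numeral k) \<le> numeral k * L" "1 \<le> 1 * (L::nat)"
    "bits x \<le> i * L \<Longrightarrow> bits y \<le> j * L \<Longrightarrow> bits (x + y) \<le> (i + j) * L"
    "bits x \<le> i * L \<Longrightarrow> bits y \<le> j * L \<Longrightarrow> bits (x - y) \<le> (i + j) * L"
    "bits x \<le> i * L \<Longrightarrow> bits y \<le> j * L \<Longrightarrow> bits (x * y) \<le> (i + j) * L"
    "bits x \<le> i * L \<Longrightarrow> bits (x div y) \<le> i * L"
    "p \<le> i * L \<Longrightarrow> q \<le> j * L \<Longrightarrow> p + q \<le> (i + j) * L"
    "p \<le> i * L \<Longrightarrow> numeral k * p \<le> (numeral k * i) * L"
    "p \<le> i * L \<Longrightarrow> Suc p \<le> (i + 1) * L"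
proof -
  show "bits 0 \<le> 1 * L" "bits 1 \<le> 1 * L" "1 \<le> 1 * L" using assms by simp_all
  have "bits (numeral k) \<le> numeral k"
    using of_nat_less_two_power[of "numeral k", where 'a = int] by (subst bits_le_iff) auto
  then show "bits (numeral k) \<le> numeral k * L"
    using mult_le_mono2[OF assms, of "numeral k"] unfolding mult_1_right by (rule order_trans)
  show "bits x \<le> i * L \<Longrightarrow> bits y \<le> j * L \<Longrightarrow> bits (x + y) \<le> (i + j) * L"
    using bits_add[of x y] by (simp add: add_mult_distrib)
  show "bits x \<le> i * L \<Longrightarrow> bits y \<le> j * L \<Longrightarrow> bits (x - y) \<le> (i + j) * L"
    using bits_diff[of x y] by (simp add: add_mult_distrib)
  show "bits x \<le> i * L \<Longrightarrow> bits y \<le> j * L \<Longrightarrow> bits (x * y) \<le> (i + j) * L"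
    using bits_mult[of x y] by (simp add: add_mult_distrib)
  show "bits x \<le> i * L \<Longrightarrow> bits (x div y) \<le> i * L"
    using bits_div[of x y] by simp
  show "p \<le> i * L \<Longrightarrow> q \<le> j * L \<Longrightarrow> p + q \<le> (i + j) * L"
    by (simp add: add_mult_distrib)
  show "p \<le> i * L \<Longrightarrow> numeral k * p \<le> (numeral k * i) * L"
    by (simp add: mult.assoc)
  show "p \<le> i * L \<Longrightarrow> Suc p \<le> (i + 1) * L"
    using assms by (simp add: add_mult_distrib)
qed

lemma floorlog_2_less_iff: "k < floorlog 2 m \<longleftrightarrow> 2 ^ k \<le> int m"
proof -
  have "k < floorlog 2 m \<longleftrightarrow> 2 ^ k \<le> m"
    using floorlog_le_iff[of 2 m k] by auto
  also have "\<dots> \<longleftrightarrow> int (2 ^ k) \<le> int m" by (simp only: of_nat_le_iff)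
  finally show ?thesis by simp
qed

text \<open>The power before the first one beyond \<open>m\<close> is at most \<open>m\<close>; the
  summand 1 is for \<open>m = 0\<close>.\<close>

lemma two_power_floorlog: "2 ^ floorlog 2 m \<le> 2 * int m + 1"
proof (cases "floorlog 2 m")
  case (Suc k)
  then have "2 ^ k \<le> int m" using floorlog_2_less_iff[of k m] by simp
  then show ?thesis unfolding Suc power_Suc by linarith
qed simp

lemma floorlog_le_bits: "floorlog 2 (nat x) \<le> bits x"
  by (cases "0 \<le> x") (simp_all add: bits_def floorlog_def)

lemma floorlog_2_le: "floorlog 2 m \<le> m"
  by (simp add: floorlog_le_iff)

section \<open>Growth of the state under one instruction\<close>

lemma sum_support_update:
  fixes f :: "'a \<Rightarrow> int" and h :: "'a \<Rightarrow> int \<Rightarrow> nat"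
  assumes "finite {x. f x \<noteq> 0}"
  shows "(\<Sum>x | (f(y := z)) x \<noteq> 0. h x ((f(y := z)) x)) \<le> (\<Sum>x | f x \<noteq> 0. h x (f x)) + h y z"
proof -
  have "(\<Sum>x | (f(y := z)) x \<noteq> 0. h x ((f(y := z)) x))
      \<le> (\<Sum>x\<in>insert y ({x. f x \<noteq> 0} - {y}). h x ((f(y := z)) x))"
    using assms by (intro sum_mono2) auto
  also have "\<dots> = h y z + (\<Sum>x\<in>{x. f x \<noteq> 0} - {y}. h x (f x))"
    using assms by (subst sum.insert) (auto intro!: sum.cong)
  also have "\<dots> \<le> h y z + (\<Sum>x | f x \<noteq> 0. h x (f x))"
    using assms by (intro add_left_mono sum_mono2) auto
  finally show ?thesis by simp
qed

lemma bits_arith_op: "bits (arith_op f x y) \<le> bits x + bits y"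
  using bits_add bits_diff bits_mult bits_div[of x y] by (cases f) (auto intro: trans_le_add1)

lemma state_size_upd_regs:
  "finite_support s \<Longrightarrow> state_size (s\<lparr>regs := (regs s)(r := z)\<rparr>) \<le> state_size s + bits z"
  using sum_support_update[of "regs s" "\<lambda>_. bits" r z]
  by (simp add: state_size_def finite_support_def del: fun_upd_apply)

lemma state_size_upd_mem:
  "finite_support s \<Longrightarrow> state_size (s\<lparr>mem := (mem s)(a := z)\<rparr>) \<le> state_size s + (bits a + bits z)"
  using sum_support_update[of "mem s" "\<lambda>a z. bits a + bits z" a z]
  by (simp add: state_size_def finite_support_def del: fun_upd_apply)

text \<open>The cost of an instruction pays for the bits it writes, so a time bound for
  straight-line code also bounds its growth in space.\<close>

lemma instr_growth:
  assumes "finite_support s"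
  shows "state_size (instr_result i s) \<le> state_size s + instr_cost i s"
proof (cases i)
  case (Const r z)
  then show ?thesis using state_size_upd_regs[OF assms] by simp
next
  case (Arith r f a b)
  then show ?thesis
    using state_size_upd_regs[OF assms, of r "arith_op f (regs s a) (regs s b)"]
      bits_arith_op[of f "regs s a" "regs s b"] by simp
next
  case (Load r a)
  then show ?thesis using state_size_upd_regs[OF assms, of r "mem s (regs s a)"] by simp
next
  case (Store a r)
  then show ?thesis using state_size_upd_mem[OF assms] by simp
qed

lemma exec_space_ge: "exec c s \<tau> \<sigma> s' \<Longrightarrow> state_size s \<le> \<sigma> \<and> state_size s' \<le> \<sigma>"
  by (induction rule: exec.induct) auto

lemma exec_time_pos: "exec c s \<tau> \<sigma> s' \<Longrightarrow> 1 \<le> \<tau>"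
proof (induction rule: exec.induct)
  case (Do i s)
  then show ?case using bits_pos by (cases i) (auto intro: trans_le_add1)
qed (use bits_pos in \<open>auto intro: trans_le_add1\<close>)

section \<open>Time and space along sequences, branches and loops\<close>

text \<open>Space is measured relative to the initial state, so that both bounds add up along
  sequential composition.\<close>

definition runs :: "com \<Rightarrow> state \<Rightarrow> nat \<Rightarrow> nat \<Rightarrow> (state \<Rightarrow> bool) \<Rightarrow> bool" where
  "runs c s T D Q \<longleftrightarrow>
     (\<exists>\<tau> \<sigma> s'. exec c s \<tau> \<sigma> s' \<and> \<tau> \<le> T \<and> \<sigma> \<le> state_size s + D \<and> Q s')"

lemma runs_Seq:
  assumes "runs c1 s T1 D1 P" "\<And>s1. P s1 \<Longrightarrow> runs c2 s1 T2 D2 Q"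
  shows "runs (Seq c1 c2) s (T1 + T2) (D1 + D2) Q"
proof -
  obtain \<tau>1 \<sigma>1 s1 where 1: "exec c1 s \<tau>1 \<sigma>1 s1" "\<tau>1 \<le> T1" "\<sigma>1 \<le> state_size s + D1" "P s1"
    using assms(1) unfolding runs_def by blast
  obtain \<tau>2 \<sigma>2 s2 where 2: "exec c2 s1 \<tau>2 \<sigma>2 s2" "\<tau>2 \<le> T2" "\<sigma>2 \<le> state_size s1 + D2" "Q s2"
    using assms(2)[OF 1(4)] unfolding runs_def by blast
  have "max \<sigma>1 \<sigma>2 \<le> state_size s + (D1 + D2)"
    using 1(3) 2(3) exec_space_ge[OF 1(1)] by simp
  then show ?thesis
    unfolding runs_def using exec.Seq[OF 1(1) 2(1)] 1(2) 2(2,4) by (meson add_mono)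
qed

lemma runs_weaken:
  assumes "runs c s T D P" "T \<le> T'" "D \<le> D'" "\<And>s'. P s' \<Longrightarrow> Q s'"
  shows "runs c s T' D' Q"
  using assms unfolding runs_def by (meson add_left_mono order_trans)

lemma runs_Skip: "Q s \<Longrightarrow> runs Skip s 1 D Q"
  unfolding runs_def using exec.Skip[of s] by fastforce

lemma runs_Do:
  "finite_support s \<Longrightarrow> instr_cost i s \<le> T \<Longrightarrow> runs (Do i) s T T (\<lambda>s'. s' = instr_result i s)"
  unfolding runs_def using exec.Do[of i s] instr_growth[of s i]
  by (intro exI[of _ "instr_cost i s"]
      exI[of _ "max (state_size s) (state_size (instr_result i s))"]
      exI[of _ "instr_result i s"]) fastforce

lemma runs_Cond:
  assumes "regs s r > 0 \<Longrightarrow> runs c1 s T D Q" "\<not> regs s r > 0 \<Longrightarrow> runs c2 s T D Q"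
  shows "runs (Cond r c1 c2) s (bits (regs s r) + T) D Q"
proof (cases "regs s r > 0")
  case True
  then show ?thesis
    using assms(1) exec.CondTrue[OF True] unfolding runs_def by (meson add_left_mono)
next
  case False
  then show ?thesis
    using assms(2) exec.CondFalse[OF False] unfolding runs_def by (meson add_left_mono)
qed

text \<open>\<open>Inv\<close> is indexed by the number of completed iterations, so their total
  \<open>K\<close> is known in advance. The extra \<open>\<beta>\<close> is the final failing test.
  Space is charged anew in each iteration, as nothing is reclaimed.\<close>

lemma runs_Loop:
  assumes step: "\<And>k s. k < K \<Longrightarrow> Inv k s \<Longrightarrow>
      regs s r > 0 \<and> bits (regs s r) \<le> \<beta> \<and> runs c s T D (Inv (Suc k))"
    and stop: "\<And>s. Inv K s \<Longrightarrow> regs s r \<le> 0 \<and> bits (regs s r) \<le> \<beta>"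
    and start: "Inv 0 s"
  shows "runs (Loop r c) s (K * (\<beta> + T) + \<beta>) (K * D) (Inv K)"
proof -
  have "runs (Loop r c) s ((K - k) * (\<beta> + T) + \<beta>) ((K - k) * D) (Inv K)"
    if "k \<le> K" "Inv k s" for k s
    using that
  proof (induction "K - k" arbitrary: k s)
    case 0
    then have "Inv K s" by simp
    then show ?case
      using stop[of s] exec.LoopFalse[of s r c] unfolding runs_def
      by (intro exI[of _ "bits (regs s r)"] exI[of _ "state_size s"] exI[of _ s]) auto
  next
    case (Suc m)
    then have k: "k < K" and m: "K - Suc k = m" by simp_all
    note st = step[OF k Suc.prems(2)]
    then obtain \<tau>1 \<sigma>1 s1 where 1: "exec c s \<tau>1 \<sigma>1 s1" "\<tau>1 \<le> T" "\<sigma>1 \<le> state_size s + D"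
      "Inv (Suc k) s1"
      unfolding runs_def by blast
    obtain \<tau>2 \<sigma>2 s2 where 2: "exec (Loop r c) s1 \<tau>2 \<sigma>2 s2" "\<tau>2 \<le> m * (\<beta> + T) + \<beta>"
      "\<sigma>2 \<le> state_size s1 + m * D" "Inv K s2"
      using Suc.hyps(1)[of "Suc k" s1] m 1(4) k unfolding runs_def by auto
    have "bits (regs s r) + \<tau>1 + \<tau>2 \<le> (K - k) * (\<beta> + T) + \<beta>"
      using st 1(2) 2(2) Suc.hyps(2)[symmetric] by simp
    moreover have "max \<sigma>1 \<sigma>2 \<le> state_size s + (K - k) * D"
      using 1(3) 2(3) exec_space_ge[OF 1(1)] Suc.hyps(2)[symmetric] by simp
    ultimately show ?case
      unfolding runs_def using exec.LoopTrue[of s r, OF _ 1(1) 2(1)] st 2(4) by blast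
  qed
  from this[of 0 s] start show ?thesis by simp
qed

fun block :: "instr list \<Rightarrow> com" where
  "block [] = Skip"
| "block (i # is) = Seq (Do i) (block is)"

fun block_result :: "instr list \<Rightarrow> state \<Rightarrow> state" where
  "block_result [] s = s"
| "block_result (i # is) s = block_result is (instr_result i s)"

fun block_cost :: "instr list \<Rightarrow> state \<Rightarrow> nat" where
  "block_cost [] s = 1"
| "block_cost (i # is) s = instr_cost i s + block_cost is (instr_result i s)"

lemma runs_block:
  "finite_support s \<Longrightarrow> block_cost is s \<le> T \<Longrightarrow>
    runs (block is) s T T (\<lambda>s'. s' = block_result is s \<and> finite_support s')"
proof (induction "is" arbitrary: s T)
  case Nil
  then show ?case
    unfolding runs_def using exec.Skip[of s] by fastforce
next
  case (Cons i "is")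
  let ?s = "instr_result i s"
  have "runs (Seq (Do i) (block is)) s (instr_cost i s + block_cost is ?s)
      (instr_cost i s + block_cost is ?s) (\<lambda>s'. s' = block_result is ?s \<and> finite_support s')"
    using Cons.prems by (intro runs_Seq[OF runs_Do]) (auto intro: Cons.IH instr_finite_support)
  then show ?case
    using Cons.prems by (auto intro: runs_weaken)
qed

lemma block_result_reset:
  "block_result (map (\<lambda>r. Const (r + 30) 0) rs) s =
     s\<lparr>regs := (\<lambda>r. if r \<in> (\<lambda>r. r + 30) ` set rs then 0 else regs s r)\<rparr>"
  by (induction rs arbitrary: s) (auto simp: fun_eq_iff)

lemma block_cost_reset: "block_cost (map (\<lambda>r. Const (r + 30) 0) rs) s = length rs + 1"
  by (induction rs arbitrary: s) auto

section \<open>Running a program in a residue class of the memory\<close>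

text \<open>Register \<open>r\<close> is kept in register \<open>r + 30\<close> and memory cell \<open>a\<close> in cell \<open>a * M + E\<close>, where
  registers 7 and 8 hold \<open>M\<close> and \<open>E\<close>. Register 29 is scratch and reset to 0 after each use.\<close>

fun simulate_instr :: "instr \<Rightarrow> com" where
  "simulate_instr (Const r z) = Do (Const (r + 30) z)"
| "simulate_instr (Arith r f a b) = Do (Arith (r + 30) f (a + 30) (b + 30))"
| "simulate_instr (Load r a) = block
     [Arith 29 Times (a + 30) 7, Arith 29 Plus 29 8, Load (r + 30) 29, Const 29 0]"
| "simulate_instr (Store a r) = block
     [Arith 29 Times (a + 30) 7, Arith 29 Plus 29 8, Store 29 (r + 30), Const 29 0]"

fun simulate :: "com \<Rightarrow> com" where
  "simulate Skip = Skip"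
| "simulate (Do i) = simulate_instr i"
| "simulate (Seq c1 c2) = Seq (simulate c1) (simulate c2)"
| "simulate (Cond r c1 c2) = Cond (r + 30) (simulate c1) (simulate c2)"
| "simulate (Loop r c) = Loop (r + 30) (simulate c)"

text \<open>\<open>s\<close> is the simulated state, \<open>u\<close> the actual one and
  \<open>u0\<close> the one in which the simulation began. The last two clauses are a frame
  condition on what the simulation leaves alone.\<close>

definition simulates :: "int \<Rightarrow> int \<Rightarrow> state \<Rightarrow> state \<Rightarrow> state \<Rightarrow> bool" where
  "simulates M E u0 s u \<longleftrightarrow> finite_support s \<and> finite_support u \<and>
     (\<forall>r. regs u (r + 30) = regs s r) \<and> (\<forall>a. mem u (a * M + E) = mem s a) \<and>
     regs u 29 = 0 \<and> (\<forall>r<29. regs u r = regs u0 r) \<and>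
     (\<forall>x. x mod M \<noteq> E \<longrightarrow> mem u x = mem u0 x)"

text \<open>The summand 1 is for a register that holds 0: it costs a bit to read but does not count
  in the state.\<close>

lemma bits_reg_le_state_size:
  assumes "finite_support s"
  shows "bits (regs s r) \<le> state_size s + 1"
proof (cases "regs s r = 0")
  case False
  then have "bits (regs s r) \<le> (\<Sum>r | regs s r \<noteq> 0. bits (regs s r))"
    using assms by (intro member_le_sum[of r _ "\<lambda>r. bits (regs s r)"]) (auto simp: finite_support_def)
  then show ?thesis by (simp add: state_size_def)
qed simp

lemma bits_mem_le_state_size:
  assumes "finite_support s"
  shows "bits (mem s a) \<le> state_size s + 1"
proof (cases "mem s a = 0")
  case False
  then have "bits a + bits (mem s a) \<le> (\<Sum>a | mem s a \<noteq> 0. bits a + bits (mem s a))"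
    using assms by (intro member_le_sum[of a _ "\<lambda>a. bits a + bits (mem s a)"])
      (auto simp: finite_support_def)
  then show ?thesis by (simp add: state_size_def)
qed simp

text \<open>Translation adds at most \<open>2 * bits M\<close> bits to an address; as
  \<open>bits a\<close> is at least 1, this is a factor of at most \<open>2 * bits M + 1\<close>.
  Whatever lies outside the simulation is already counted in \<open>u0\<close>.\<close>

lemma simulates_state_size:
  assumes sim: "simulates M E u0 s u" and E: "0 \<le> E" "E < M" and fin0: "finite_support u0"
  shows "state_size u \<le> state_size u0 + (2 * bits M + 1) * state_size s"
proof -
  let ?k = "2 * bits M + 1"
  let ?h = "\<lambda>u x. bits x + bits (mem u x)"
  note sim = sim[unfolded simulates_def]
  have fin: "finite {r. regs s r \<noteq> 0}" "finite {a. mem s a \<noteq> 0}"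
    "finite {r. regs u0 r \<noteq> 0}" "finite {a. mem u0 a \<noteq> 0}"
    "finite {r. regs u r \<noteq> 0}" "finite {a. mem u a \<noteq> 0}"
    using sim fin0 unfolding finite_support_def by blast+
  have "{r. regs u r \<noteq> 0} \<subseteq> {r. regs u0 r \<noteq> 0 \<and> r < 29} \<union> (\<lambda>r. r + 30) ` {r. regs s r \<noteq> 0}"
  proof
    fix r assume r: "r \<in> {r. regs u r \<noteq> 0}"
    consider "r < 29" | "r = 29" | "30 \<le> r" by linarith
    then show "r \<in> {r. regs u0 r \<noteq> 0 \<and> r < 29} \<union> (\<lambda>r. r + 30) ` {r. regs s r \<noteq> 0}"
    proof cases
      case 3
      then obtain q where "r = q + 30" by (metis add.commute le_Suc_ex)
      then show ?thesis using r sim by auto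
    qed (use r sim in auto)
  qed
  then have "(\<Sum>r | regs u r \<noteq> 0. bits (regs u r))
      \<le> (\<Sum>r\<in>{r. regs u0 r \<noteq> 0 \<and> r < 29} \<union> (\<lambda>r. r + 30) ` {r. regs s r \<noteq> 0}. bits (regs u r))"
    using fin by (intro sum_mono2) auto
  also have "\<dots> = (\<Sum>r | regs u0 r \<noteq> 0 \<and> r < 29. bits (regs u r))
      + (\<Sum>r\<in>(\<lambda>r. r + 30) ` {r. regs s r \<noteq> 0}. bits (regs u r))"
    using fin by (intro sum.union_disjoint) auto
  also have "(\<Sum>r | regs u0 r \<noteq> 0 \<and> r < 29. bits (regs u r))
      = (\<Sum>r | regs u0 r \<noteq> 0 \<and> r < 29. bits (regs u0 r))"
    using sim by (intro sum.cong) auto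
  also have "\<dots> \<le> (\<Sum>r | regs u0 r \<noteq> 0. bits (regs u0 r))"
    using fin by (intro sum_mono2) auto
  also have "(\<Sum>r\<in>(\<lambda>r. r + 30) ` {r. regs s r \<noteq> 0}. bits (regs u r))
      = (\<Sum>r | regs s r \<noteq> 0. bits (regs s r))"
    using sim by (subst sum.reindex) auto
  finally have R: "(\<Sum>r | regs u r \<noteq> 0. bits (regs u r))
      \<le> (\<Sum>r | regs u0 r \<noteq> 0. bits (regs u0 r)) + (\<Sum>r | regs s r \<noteq> 0. bits (regs s r))"
    by simp
  let ?f = "\<lambda>a. a * M + E"
  have dm: "?f (x div M) = x" if "x mod M = E" for x
    using that by (metis div_mult_mod_eq)
  have md: "?f a mod M = E" for a using E by simp
  have "{x. mem u x \<noteq> 0} \<subseteq> {x. mem u0 x \<noteq> 0 \<and> x mod M \<noteq> E} \<union> ?f ` {a. mem s a \<noteq> 0}"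
  proof
    fix x assume x: "x \<in> {x. mem u x \<noteq> 0}"
    show "x \<in> {x. mem u0 x \<noteq> 0 \<and> x mod M \<noteq> E} \<union> ?f ` {a. mem s a \<noteq> 0}"
    proof (cases "x mod M = E")
      case True
      have "mem s (x div M) = mem u x"
        using sim dm[OF True] by metis
      then show ?thesis
        using x by (intro UnI2 image_eqI[where x = "x div M"]) (simp_all add: dm[OF True])
    qed (use x sim in auto)
  qed
  then have "(\<Sum>x | mem u x \<noteq> 0. ?h u x)
      \<le> (\<Sum>x\<in>{x. mem u0 x \<noteq> 0 \<and> x mod M \<noteq> E} \<union> ?f ` {a. mem s a \<noteq> 0}. ?h u x)"
    using fin by (intro sum_mono2) auto
  also have "\<dots> = (\<Sum>x | mem u0 x \<noteq> 0 \<and> x mod M \<noteq> E. ?h u x)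
      + (\<Sum>x\<in>?f ` {a. mem s a \<noteq> 0}. ?h u x)"
    using fin md by (intro sum.union_disjoint) auto
  also have "(\<Sum>x | mem u0 x \<noteq> 0 \<and> x mod M \<noteq> E. ?h u x)
      = (\<Sum>x | mem u0 x \<noteq> 0 \<and> x mod M \<noteq> E. ?h u0 x)"
    using sim by (intro sum.cong) auto
  also have "\<dots> \<le> (\<Sum>x | mem u0 x \<noteq> 0. ?h u0 x)"
    using fin by (intro sum_mono2) auto
  also have "(\<Sum>x\<in>?f ` {a. mem s a \<noteq> 0}. ?h u x)
      = (\<Sum>a | mem s a \<noteq> 0. bits (?f a) + bits (mem s a))"
    using sim E by (subst sum.reindex) (auto simp: inj_on_def)
  also have "\<dots> \<le> (\<Sum>a | mem s a \<noteq> 0. ?k * ?h s a)"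
  proof (rule sum_mono)
    fix a
    have "bits (?f a) \<le> bits a + bits M + bits E"
      using bits_add[of "a * M" E] bits_mult[of a M] by linarith
    also have "\<dots> \<le> bits a + 2 * bits M * 1"
      using bits_mono[of E M] E by simp
    also have "\<dots> \<le> bits a + 2 * bits M * bits a"
      by (intro add_left_mono mult_left_mono bits_pos) simp
    finally show "bits (?f a) + bits (mem s a) \<le> ?k * ?h s a"
      by (simp add: algebra_simps)
  qed
  finally have "(\<Sum>x | mem u x \<noteq> 0. ?h u x)
      \<le> (\<Sum>x | mem u0 x \<noteq> 0. ?h u0 x) + ?k * (\<Sum>a | mem s a \<noteq> 0. ?h s a)"
    by (simp add: sum_distrib_left)
  then show ?thesis
    using R unfolding state_size_def by (simp add: algebra_simps)
qed

text \<open>A load or store becomes a block whose inner states, with an address in register 29,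
  simulate no state. Their size is bounded by the size before the block plus its cost, and the cost
  by the size of the state holding the operands; hence \<open>3 * \<sigma> + 2\<close>. The 5 in
  \<open>5 * bits M\<close> counts how often \<open>bits M\<close> occurs in the estimate for that
  block.\<close>

lemma simulate_instr_exec:
  fixes i :: instr
  assumes sim: "simulates M E u0 s u" and E: "0 \<le> E" "E < M"
    and u0: "regs u0 7 = M" "regs u0 8 = E"
    and fin0: "finite_support u0"
  defines "\<kappa> \<equiv> 5 * bits M + 5"
    and "\<sigma> \<equiv> max (state_size s) (state_size (instr_result i s))"
  shows "\<exists>\<tau>' \<sigma>' u'. exec (simulate_instr i) u \<tau>' \<sigma>' u' \<and> \<tau>' \<le> \<kappa> * instr_cost i s \<and>
    \<sigma>' \<le> state_size u0 + \<kappa> * (3 * \<sigma> + 2) \<and> simulates M E u0 (instr_result i s) u'"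
proof -
  note size = simulates_state_size[OF _ E fin0]
  have k1: "1 \<le> \<kappa>" "2 * bits M + 1 \<le> \<kappa>" by (simp_all add: \<kappa>_def)
  have size': "state_size v \<le> state_size u0 + \<kappa> * (3 * \<sigma> + 2)"
    if "simulates M E u0 r v" "state_size r \<le> \<sigma>" for r v
  proof -
    have "(2 * bits M + 1) * state_size r \<le> \<kappa> * (3 * \<sigma> + 2)"
      using that(2) k1 by (intro mult_mono) auto
    then show ?thesis using size[OF that(1)] by linarith
  qed
  have sim': "finite_support s" "finite_support u" "\<And>r. regs u (r + 30) = regs s r"
    "\<And>a. mem u (a * M + E) = mem s a" "regs u 29 = 0" "\<And>r. r < 29 \<Longrightarrow> regs u r = regs u0 r"
    "\<And>x. x mod M \<noteq> E \<Longrightarrow> mem u x = mem u0 x"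
    using sim by (auto simp: simulates_def)
  have u: "regs u 7 = M" "regs u 8 = E" using sim'(6) u0 by auto
  have shift: "r + 30 \<noteq> 29" "r + 30 < 29 \<longleftrightarrow> False" "r + 30 = k + 30 \<longleftrightarrow> r = k" for r k :: nat
    by auto
  have bE: "bits E \<le> bits M"
    using bits_mono[of E M] E by simp
  have addr: "bits (a * M + E) \<le> bits a + 2 * bits M" "bits (a * M) \<le> bits a + bits M" for a
    using bits_add[of "a * M" E] bits_mult[of a M] bE by simp_all
  have inst: "instr_cost i s \<le> 2 * \<sigma> + 2" if mi: "\<exists>r a. i = Load r a \<or> i = Store r a"
  proof -
    have "bits (regs s r) \<le> \<sigma> + 1" "bits (mem s a) \<le> \<sigma> + 1" for r a
      using bits_reg_le_state_size[OF sim'(1), of r] bits_mem_le_state_size[OF sim'(1), of a]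
      by (simp_all add: \<sigma>_def)
    note b = this
    consider r a where "i = Load r a" | r a where "i = Store r a" using mi by blast
    then show ?thesis
    proof cases
      case (1 r a)
      then show ?thesis using add_mono[OF b(1)[of a] b(2)[of "regs s a"]] by simp
    next
      case (2 r a)
      then show ?thesis using add_mono[OF b(1)[of a] b(1)[of r]] by simp
    qed
  qed
  have "finite_support (instr_result i s)"
    using sim'(1) by (rule instr_finite_support)
  note fin' = this
  have mem_case: ?thesis
    if si: "simulate_instr i = block is" and m: "\<exists>r a. i = Load r a \<or> i = Store r a"
      and cost: "block_cost is u \<le> \<kappa> * instr_cost i s"
      and s': "simulates M E u0 (instr_result i s) (block_result is u)" for "is"
  proof -
    obtain \<tau>' \<sigma>' where ex: "exec (block is) u \<tau>' \<sigma>' (block_result is u)"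
      "\<tau>' \<le> \<kappa> * instr_cost i s" "\<sigma>' \<le> state_size u + \<kappa> * instr_cost i s"
      using runs_block[OF sim'(2) cost] unfolding runs_def by blast
    have "state_size u \<le> state_size u0 + \<kappa> * \<sigma>"
    proof -
      have "(2 * bits M + 1) * state_size s \<le> \<kappa> * \<sigma>"
        using k1 by (intro mult_mono) (auto simp: \<sigma>_def)
      then show ?thesis using size[OF sim] by linarith
    qed
    moreover have "\<kappa> * instr_cost i s \<le> \<kappa> * (2 * \<sigma> + 2)"
      using inst m by (intro mult_left_mono) auto
    ultimately have "\<sigma>' \<le> state_size u0 + \<kappa> * (3 * \<sigma> + 2)"
      using ex(3) by (simp add: algebra_simps)
    then show ?thesis unfolding si using ex(1,2) s' by blast
  qed
  have reg_case: ?thesis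
    if si: "simulate_instr i = Do i'" and cost: "instr_cost i' u = instr_cost i s"
      and s': "simulates M E u0 (instr_result i s) (instr_result i' u)" for i'
  proof -
    have "max (state_size u) (state_size (instr_result i' u)) \<le> state_size u0 + \<kappa> * (3 * \<sigma> + 2)"
      using size'[OF sim] size'[OF s'] by (simp add: \<sigma>_def)
    moreover have "instr_cost i' u \<le> \<kappa> * instr_cost i s"
      using cost k1(1) by simp
    ultimately show ?thesis unfolding si using exec.Do[of i' u] s' by blast
  qed
  have inj: "a * M + E = b * M + E \<longleftrightarrow> a = b" for a b using E by simp
  have md: "(a * M + E) mod M = E" for a using E by simp
  show ?thesis
  proof (cases i)
    case (Const r z)
    show ?thesis
      by (rule reg_case[of "Const (r + 30) z"])
        (use sim' fin' in \<open>auto simp: Const simulates_def instr_finite_support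
            intro!: instr_finite_support[of u "Const (r + 30) z", simplified]\<close>)
  next
    case (Arith r f a b)
    show ?thesis
      by (rule reg_case[of "Arith (r + 30) f (a + 30) (b + 30)"])
        (use sim' fin' instr_finite_support[of u "Arith (r + 30) f (a + 30) (b + 30)"]
          in \<open>auto simp: Arith simulates_def\<close>)
  next
    case (Load r a)
    let ?is = "[Arith 29 Times (a + 30) 7, Arith 29 Plus 29 8, Load (r + 30) 29, Const 29 0]"
    have fu: "finite_support (block_result ?is u)"
      using sim'(2) by (simp add: instr_finite_support del: instr_result.simps)
    have r: "regs (block_result ?is u) = (regs u)(29 := 0, r + 30 := mem s (regs s a))"
      "mem (block_result ?is u) = mem u"
      using sim' u by (auto simp: shift)
    show ?thesis
    proof (rule mem_case)
      show "block_cost ?is u \<le> \<kappa> * instr_cost i s"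
      proof -
        have "block_cost ?is u \<le> 3 * bits (regs s a) + 5 * bits M + bits (mem s (regs s a)) + 2"
          using sim'(3,4) u addr[of "regs s a"] bE by (simp add: shift)
        also have "\<dots> \<le> \<kappa> * instr_cost i s"
        proof -
          have "5 * bits M * 1 \<le> 5 * bits M * (bits (regs s a) + bits (mem s (regs s a)))"
            using bits_pos by (intro mult_left_mono trans_le_add1) auto
          then show ?thesis using bits_pos[of "regs s a"] unfolding \<kappa>_def Load
            by (simp add: algebra_simps)
        qed
        finally show ?thesis .
      qed
      show "simulates M E u0 (instr_result i s) (block_result ?is u)"
        using sim' fin' fu unfolding simulates_def r by (auto simp: Load)
    qed (simp_all add: Load)
  next
    case (Store a r)
    let ?is = "[Arith 29 Times (a + 30) 7, Arith 29 Plus 29 8, Store 29 (r + 30), Const 29 0]"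
    have fu: "finite_support (block_result ?is u)"
      using sim'(2) by (simp add: instr_finite_support del: instr_result.simps)
    have r: "regs (block_result ?is u) = (regs u)(29 := 0)"
      "mem (block_result ?is u) = (mem u)(regs s a * M + E := regs s r)"
      using sim' u by (auto simp: shift)
    show ?thesis
    proof (rule mem_case)
      show "block_cost ?is u \<le> \<kappa> * instr_cost i s"
      proof -
        have "block_cost ?is u \<le> 3 * bits (regs s a) + 5 * bits M + bits (regs s r) + 2"
          using sim'(3,4) u addr[of "regs s a"] bE by (simp add: shift)
        also have "\<dots> \<le> \<kappa> * instr_cost i s"
        proof -
          have "5 * bits M * 1 \<le> 5 * bits M * (bits (regs s a) + bits (regs s r))"
            using bits_pos by (intro mult_left_mono trans_le_add1) auto
          then show ?thesis using bits_pos[of "regs s a"] unfolding \<kappa>_def Store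
            by (simp add: algebra_simps)
        qed
        finally show ?thesis .
      qed
      show "simulates M E u0 (instr_result i s) (block_result ?is u)"
        using sim' fin' fu md inj unfolding simulates_def r by (auto simp: Store)
    qed (simp_all add: Store)
  qed
qed

text \<open>The space bound is relative to \<open>u0\<close> and is derived afresh, through
  \<open>simulates\<close>, for each state reached. So it is a maximum along the run; adding up
  growth as in \<open>runs\<close> would bring in the running time.\<close>

lemma simulate_exec:
  assumes "exec c s \<tau> \<sigma> s'" and "simulates M E u0 s u" and E: "0 \<le> E" "E < M"
    and u0: "regs u0 7 = M" "regs u0 8 = E" "finite_support u0"
  shows "\<exists>\<tau>' \<sigma>' u'. exec (simulate c) u \<tau>' \<sigma>' u' \<and> \<tau>' \<le> (5 * bits M + 5) * \<tau> \<and>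
    \<sigma>' \<le> state_size u0 + (5 * bits M + 5) * (3 * \<sigma> + 2) \<and> simulates M E u0 s' u'"
  using assms(1,2)
proof (induction arbitrary: u rule: exec.induct)
  case (Skip s)
  have "(2 * bits M + 1) * state_size s \<le> (5 * bits M + 5) * (3 * state_size s + 2)"
    by (intro mult_mono) auto
  then have "state_size u \<le> state_size u0 + (5 * bits M + 5) * (3 * state_size s + 2)"
    using simulates_state_size[OF Skip E u0(3)] by linarith
  then show ?case using exec.Skip[of u] Skip by fastforce
next
  case (Do i s)
  show ?case using simulate_instr_exec[OF Do E u0, of i] by simp
next
  case (Seq c1 s \<tau>1 \<sigma>1 s1 c2 \<tau>2 \<sigma>2 s2)
  obtain \<tau>1' \<sigma>1' u1 where 1: "exec (simulate c1) u \<tau>1' \<sigma>1' u1" "\<tau>1' \<le> (5 * bits M + 5) * \<tau>1"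
    "\<sigma>1' \<le> state_size u0 + (5 * bits M + 5) * (3 * \<sigma>1 + 2)" "simulates M E u0 s1 u1"
    using Seq.IH(1)[OF Seq.prems] by blast
  obtain \<tau>2' \<sigma>2' u2 where 2: "exec (simulate c2) u1 \<tau>2' \<sigma>2' u2" "\<tau>2' \<le> (5 * bits M + 5) * \<tau>2"
    "\<sigma>2' \<le> state_size u0 + (5 * bits M + 5) * (3 * \<sigma>2 + 2)" "simulates M E u0 s2 u2"
    using Seq.IH(2)[OF 1(4)] by blast
  have "\<sigma>' \<le> state_size u0 + (5 * bits M + 5) * (3 * max \<sigma>1 \<sigma>2 + 2)"
    if "\<sigma>' \<le> state_size u0 + (5 * bits M + 5) * (3 * \<sigma> + 2)" "\<sigma> \<le> max \<sigma>1 \<sigma>2" for \<sigma> \<sigma>'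
    using that by (meson add_le_mono le_refl mult_le_mono order_trans)
  from this[OF 1(3)] this[OF 2(3)] exec.Seq[OF 1(1) 2(1)] 1(2) 2(2,4) show ?case
    by (intro exI[of _ "\<tau>1' + \<tau>2'"] exI[of _ "max \<sigma>1' \<sigma>2'"] exI[of _ u2])
      (auto simp: add_mult_distrib2)
next
  case (CondTrue s r c1 \<tau> \<sigma> s' c2)
  have r: "regs u (r + 30) = regs s r" using CondTrue.prems by (simp add: simulates_def)
  obtain \<tau>' \<sigma>' u' where 1: "exec (simulate c1) u \<tau>' \<sigma>' u'" "\<tau>' \<le> (5 * bits M + 5) * \<tau>"
    "\<sigma>' \<le> state_size u0 + (5 * bits M + 5) * (3 * \<sigma> + 2)" "simulates M E u0 s' u'"
    using CondTrue.IH[OF CondTrue.prems] by blast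
  have "exec (simulate (Cond r c1 c2)) u (bits (regs s r) + \<tau>') \<sigma>' u'"
    using exec.CondTrue[OF _ 1(1), of "r + 30"] CondTrue.hyps r by simp
  moreover have "bits (regs s r) + \<tau>' \<le> (5 * bits M + 5) * (bits (regs s r) + \<tau>)"
    using add_mono[OF _ 1(2), of "bits (regs s r)" "(5 * bits M + 5) * bits (regs s r)"]
    by (simp add: add_mult_distrib2)
  ultimately show ?case using 1(3,4) by blast
next
  case (CondFalse s r c2 \<tau> \<sigma> s' c1)
  have r: "regs u (r + 30) = regs s r" using CondFalse.prems by (simp add: simulates_def)
  obtain \<tau>' \<sigma>' u' where 1: "exec (simulate c2) u \<tau>' \<sigma>' u'" "\<tau>' \<le> (5 * bits M + 5) * \<tau>"
    "\<sigma>' \<le> state_size u0 + (5 * bits M + 5) * (3 * \<sigma> + 2)" "simulates M E u0 s' u'"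
    using CondFalse.IH[OF CondFalse.prems] by blast
  have "exec (simulate (Cond r c1 c2)) u (bits (regs s r) + \<tau>') \<sigma>' u'"
    using exec.CondFalse[OF _ 1(1), of "r + 30"] CondFalse.hyps r by simp
  moreover have "bits (regs s r) + \<tau>' \<le> (5 * bits M + 5) * (bits (regs s r) + \<tau>)"
    using add_mono[OF _ 1(2), of "bits (regs s r)" "(5 * bits M + 5) * bits (regs s r)"]
    by (simp add: add_mult_distrib2)
  ultimately show ?case using 1(3,4) by blast
next
  case (LoopFalse s r c)
  have r: "regs u (r + 30) = regs s r" using LoopFalse.prems by (simp add: simulates_def)
  have "(2 * bits M + 1) * state_size s \<le> (5 * bits M + 5) * (3 * state_size s + 2)"
    by (intro mult_mono) auto
  then have "state_size u \<le> state_size u0 + (5 * bits M + 5) * (3 * state_size s + 2)"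
    using simulates_state_size[OF LoopFalse.prems E u0(3)] by linarith
  then show ?case
    using exec.LoopFalse[of u "r + 30" "simulate c"] LoopFalse r
    by (intro exI[of _ "bits (regs s r)"] exI[of _ "state_size u"] exI[of _ u]) auto
next
  case (LoopTrue s r c \<tau>1 \<sigma>1 s1 \<tau>2 \<sigma>2 s2)
  have r: "regs u (r + 30) = regs s r" using LoopTrue.prems by (simp add: simulates_def)
  obtain \<tau>1' \<sigma>1' u1 where 1: "exec (simulate c) u \<tau>1' \<sigma>1' u1" "\<tau>1' \<le> (5 * bits M + 5) * \<tau>1"
    "\<sigma>1' \<le> state_size u0 + (5 * bits M + 5) * (3 * \<sigma>1 + 2)" "simulates M E u0 s1 u1"
    using LoopTrue.IH(1)[OF LoopTrue.prems] by blast
  obtain \<tau>2' \<sigma>2' u2 where 2: "exec (simulate (Loop r c)) u1 \<tau>2' \<sigma>2' u2"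
    "\<tau>2' \<le> (5 * bits M + 5) * \<tau>2"
    "\<sigma>2' \<le> state_size u0 + (5 * bits M + 5) * (3 * \<sigma>2 + 2)" "simulates M E u0 s2 u2"
    using LoopTrue.IH(2)[OF 1(4)] by blast
  have *: "\<sigma>' \<le> state_size u0 + (5 * bits M + 5) * (3 * max \<sigma>1 \<sigma>2 + 2)"
    if "\<sigma>' \<le> state_size u0 + (5 * bits M + 5) * (3 * \<sigma> + 2)" "\<sigma> \<le> max \<sigma>1 \<sigma>2" for \<sigma> \<sigma>'
    using that by (meson add_le_mono le_refl mult_le_mono order_trans)
  have "exec (simulate (Loop r c)) u (bits (regs s r) + \<tau>1' + \<tau>2') (max \<sigma>1' \<sigma>2') u2"
    using exec.LoopTrue[OF _ 1(1), of "r + 30"] 2(1) LoopTrue.hyps(1) r by simp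
  moreover have "bits (regs s r) + \<tau>1' + \<tau>2' \<le> (5 * bits M + 5) * (bits (regs s r) + \<tau>1 + \<tau>2)"
    using add_mono[OF add_mono[OF _ 1(2), of "bits (regs s r)" "(5 * bits M + 5) * bits (regs s r)"] 2(2)]
    by (simp add: add_mult_distrib2)
  moreover have "max \<sigma>1' \<sigma>2' \<le> state_size u0 + (5 * bits M + 5) * (3 * max \<sigma>1 \<sigma>2 + 2)"
    using *[OF 1(3)] *[OF 2(3)] by simp
  ultimately show ?case using 2(4) by blast
qed

text \<open>Registers are named in the program text, so those it may change are known before it runs
  and a fixed block can reset them.\<close>

fun written_below :: "com \<Rightarrow> nat" where
  "written_below Skip = 0"
| "written_below (Do (Const r z)) = Suc r"
| "written_below (Do (Arith r f a b)) = Suc r"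
| "written_below (Do (Load r a)) = Suc r"
| "written_below (Do (Store a r)) = 0"
| "written_below (Seq c1 c2) = max (written_below c1) (written_below c2)"
| "written_below (Cond r c1 c2) = max (written_below c1) (written_below c2)"
| "written_below (Loop r c) = written_below c"

lemma exec_written_below:
  "exec c s \<tau> \<sigma> s' \<Longrightarrow> written_below c \<le> r \<Longrightarrow> regs s' r = regs s r"
proof (induction rule: exec.induct)
  case (Do i s)
  then show ?case by (cases i) auto
qed auto

section \<open>Reduction to exact queries\<close>

text \<open>Ceiling of the quotient for positive \<open>y\<close>, expressed by the division that
  the machine offers.\<close>

definition cdiv :: "int \<Rightarrow> int \<Rightarrow> int" where
  "cdiv x y = (x + y - 1) div y"

lemma div_less_iff_int: "0 < y \<Longrightarrow> x div y < z \<longleftrightarrow> x < z * y" for x y z :: int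
proof
  assume y: "0 < y" and "x div y < z"
  then have "(x div y + 1) * y \<le> z * y" by (intro mult_right_mono) auto
  then show "x < z * y"
    using pos_mod_bound[OF y, of x] div_mult_mod_eq[of x y] distrib_right[of "x div y" 1 y] by linarith
next
  assume y: "0 < y" and "x < z * y"
  then have "x div y * y < z * y"
    using pos_mod_sign[OF y, of x] div_mult_mod_eq[of x y] by linarith
  then show "x div y < z" using y by simp
qed

lemma cdiv_le_iff: "0 < y \<Longrightarrow> cdiv x y \<le> z \<longleftrightarrow> x \<le> z * y"
  using div_less_iff_int[of y "x + y - 1" "z + 1"] by (auto simp: cdiv_def algebra_simps)

lemma le_div_iff_int: "0 < y \<Longrightarrow> z \<le> x div y \<longleftrightarrow> z * y \<le> x" for x y z :: int
  using div_less_iff_int[of y x z] by linarith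

text \<open>\<open>j1\<close> and \<open>j2\<close> number the candidate sums from 1, upwards from
  the rounded \<open>t\<close> and downwards from the rounded \<open>b\<close>.\<close>

definition hits :: "(nat \<Rightarrow> int) \<Rightarrow> (nat \<Rightarrow> int) \<Rightarrow> int \<Rightarrow> int \<Rightarrow> int \<Rightarrow> int \<Rightarrow> int \<Rightarrow> int \<Rightarrow> nat set \<Rightarrow> bool" where
  "hits \<omega> \<nu> t b P1 P2 j1 j2 X \<longleftrightarrow>
     (\<Sum>e\<in>X. \<omega> e div P1) = cdiv t P1 + j1 - 1 \<and> (\<Sum>e\<in>X. cdiv (\<nu> e) P2) = b div P2 - j2 + 1"

text \<open>Rounding errs on the safe side: scaled back, the rounded \<open>\<omega>\<close>
  underestimates and the rounded \<open>\<nu>\<close> overestimates. So a hit at any scale and any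
  offset gives a solution.\<close>

lemma hits_sound:
  assumes "hits \<omega> \<nu> t b P1 P2 j1 j2 X" "0 < P1" "0 < P2" "1 \<le> j1" "1 \<le> j2"
  shows "t \<le> sum \<omega> X" "sum \<nu> X \<le> b"
proof -
  have "cdiv t P1 \<le> (\<Sum>e\<in>X. \<omega> e div P1)"
    using assms by (simp add: hits_def)
  then have "t \<le> (\<Sum>e\<in>X. \<omega> e div P1) * P1"
    using assms by (simp add: cdiv_le_iff)
  also have "\<dots> = (\<Sum>e\<in>X. \<omega> e div P1 * P1)" by (rule sum_distrib_right)
  also have "\<dots> \<le> sum \<omega> X"
    using assms le_div_iff_int[of P1 "_ div P1"] by (intro sum_mono) blast
  finally show "t \<le> sum \<omega> X" .
  have "sum \<nu> X \<le> (\<Sum>e\<in>X. cdiv (\<nu> e) P2 * P2)"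
    using assms cdiv_le_iff[of P2 _ "cdiv _ P2"] by (intro sum_mono) blast
  also have "\<dots> = (\<Sum>e\<in>X. cdiv (\<nu> e) P2) * P2" by (simp add: sum_distrib_right)
  also have "\<dots> \<le> (b div P2) * P2"
    using assms by (intro mult_right_mono) (auto simp: hits_def)
  also have "\<dots> \<le> b" using assms le_div_iff_int[of P2 "b div P2" b] by simp
  finally show "sum \<nu> X \<le> b" .
qed

text \<open>\<open>k\<close> is the index before the first failure; this one change of the predicate
  is all that the scale argument uses.\<close>

lemma last_satisfying:
  fixes Pr :: "nat \<Rightarrow> bool"
  assumes "Pr 0" "\<not> Pr m"
  obtains k where "k < m" "Pr k" "\<not> Pr (Suc k)"
  using assms ex_least_nat_le[of "\<lambda>k. \<not> Pr k" m]
  by (metis less_Suc_eq_le less_eq_Suc_le not_less_eq_eq old.nat.exhaust order_refl)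

text \<open>With \<open>W k\<close> and \<open>V k\<close> the rounded sums at scale
  \<open>2 ^ k\<close>, rounding gives \<open>W k \<le> 2 * W (k + 1) + card X\<close> and
  \<open>2 * V (k + 1) \<le> V k + card X\<close>. A comparison that holds at \<open>k\<close> and
  fails at \<open>k + 1\<close> therefore leaves fewer than \<open>n\<close> units between the sum
  and the rounded threshold.\<close>

lemma hits_complete:
  assumes X: "X \<subseteq> {1..n}" and t: "0 < t" "t \<le> sum \<omega> X" and b: "sum \<nu> X \<le> b"
    and pos: "\<And>e. e \<in> X \<Longrightarrow> 0 < \<nu> e" and N: "\<And>e. e \<in> X \<Longrightarrow> 0 \<le> \<omega> e \<and> \<omega> e < 2 ^ K1"
    and K2: "b < 2 ^ K2"
  obtains k1 k2 j1 j2 where "k1 < K1" "k2 < K2" "j1 \<in> {1..int n}" "j2 \<in> {1..int n}"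
    "hits \<omega> \<nu> t b (2 ^ k1) (2 ^ k2) j1 j2 X"
proof -
  let ?W = "\<lambda>k. \<Sum>e\<in>X. \<omega> e div 2 ^ k" and ?V = "\<lambda>k. \<Sum>e\<in>X. cdiv (\<nu> e) (2 ^ k)"
  have fin: "finite X" and card: "int (card X) \<le> int n"
    using X finite_subset[OF X] card_mono[OF _ X] by auto
  \<comment> \<open>This is where \<open>0 < t\<close> matters: for the empty set the comparison
    with \<open>b\<close> would fail at no scale.\<close>
  have ne: "X \<noteq> {}" using t by auto
  have "?W 0 * 2 ^ 0 \<ge> t" using t by simp
  \<comment> \<open>All weights are below \<open>2 ^ K1\<close>, so the rounded sum is 0
    there.\<close>
  moreover have "\<not> ?W K1 * 2 ^ K1 \<ge> t" using N t by simp
  ultimately obtain k1 where k1: "k1 < K1" "?W k1 * 2 ^ k1 \<ge> t" "\<not> ?W (Suc k1) * 2 ^ Suc k1 \<ge> t"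
    by (rule last_satisfying[of "\<lambda>k. ?W k * 2 ^ k \<ge> t"])
  have "?W k1 \<le> (\<Sum>e\<in>X. 2 * (\<omega> e div 2 ^ Suc k1) + 1)"
  proof (rule sum_mono)
    fix e
    show "\<omega> e div 2 ^ k1 \<le> 2 * (\<omega> e div 2 ^ Suc k1) + 1"
      by (simp add: zdiv_zmult2_eq[of 2 _ "2 ^ k1"] mult.commute[of 2])
  qed
  also have "\<dots> = 2 * ?W (Suc k1) + card X"
    using fin by (simp add: sum.distrib sum_distrib_left)
  finally have "?W k1 - n \<le> 2 * ?W (Suc k1)" using card by simp
  then have "(?W k1 - n) * 2 ^ k1 \<le> 2 * ?W (Suc k1) * 2 ^ k1"
    by (intro mult_right_mono) auto
  also have "\<dots> = ?W (Suc k1) * 2 ^ Suc k1" by simp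
  also have "\<dots> < t" using k1(3) by simp
  finally have "?W k1 - n < cdiv t (2 ^ k1)"
    using cdiv_le_iff[of "2 ^ k1" t "?W k1 - n"] by simp
  moreover have "cdiv t (2 ^ k1) \<le> ?W k1"
    using k1(2) by (simp add: cdiv_le_iff)
  ultimately have j1: "?W k1 - cdiv t (2 ^ k1) + 1 \<in> {1..int n}" by simp
  have "?V 0 * 2 ^ 0 \<le> b" using b by (simp add: cdiv_def)
  moreover have "\<not> ?V K2 * 2 ^ K2 \<le> b"
  proof -
    have "1 \<le> ?V K2"
    proof -
      have "1 \<le> cdiv (\<nu> e) (2 ^ K2)" if "e \<in> X" for e
        using pos[OF that] cdiv_le_iff[of "2 ^ K2" "\<nu> e" 0] by simp
      then have "(\<Sum>e\<in>X. 1) \<le> ?V K2" by (rule sum_mono)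
      then show ?thesis using fin ne by (simp add: Suc_le_eq card_gt_0_iff order.trans[rotated])
    qed
    then have "1 * 2 ^ K2 \<le> ?V K2 * 2 ^ K2" by (intro mult_right_mono) auto
    then show ?thesis using K2 by linarith
  qed
  ultimately obtain k2 where k2: "k2 < K2" "?V k2 * 2 ^ k2 \<le> b" "\<not> ?V (Suc k2) * 2 ^ Suc k2 \<le> b"
    by (rule last_satisfying[of "\<lambda>k. ?V k * 2 ^ k \<le> b"])
  have "(\<Sum>e\<in>X. 2 * cdiv (\<nu> e) (2 ^ Suc k2)) \<le> (\<Sum>e\<in>X. cdiv (\<nu> e) (2 ^ k2) + 1)"
  proof (rule sum_mono)
    fix e
    let ?c = "cdiv (\<nu> e) (2 ^ k2)"
    have "\<nu> e \<le> ?c * 2 ^ k2" using cdiv_le_iff[of "2 ^ k2" "\<nu> e" ?c] by simp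
    \<comment> \<open>\<open>(?c + 1) div 2\<close> is half of \<open>?c\<close> rounded up, so its
      double is at least \<open>?c\<close>.\<close>
    also have "\<dots> \<le> (((?c + 1) div 2) * 2) * 2 ^ k2"
      by (intro mult_right_mono) (linarith, simp)
    finally have "cdiv (\<nu> e) (2 ^ Suc k2) \<le> (?c + 1) div 2"
      by (simp add: cdiv_le_iff mult.assoc)
    then show "2 * cdiv (\<nu> e) (2 ^ Suc k2) \<le> ?c + 1" by linarith
  qed
  also have "\<dots> = ?V k2 + card X" using fin by (simp add: sum.distrib)
  finally have "?V (Suc k2) * 2 \<le> ?V k2 + n"
    using card unfolding sum_distrib_left[symmetric] by linarith
  then have "?V (Suc k2) * 2 * 2 ^ k2 \<le> (?V k2 + n) * 2 ^ k2"
    by (intro mult_right_mono) auto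
  moreover have "?V (Suc k2) * 2 * 2 ^ k2 = ?V (Suc k2) * 2 ^ Suc k2" by simp
  ultimately have "b < (?V k2 + n) * 2 ^ k2" using k2(3) by linarith
  then have "b div 2 ^ k2 < ?V k2 + n" by (simp add: div_less_iff_int)
  moreover have "?V k2 \<le> b div 2 ^ k2" using k2(2) by (simp add: le_div_iff_int)
  ultimately have j2: "b div 2 ^ k2 - ?V k2 + 1 \<in> {1..int n}" by simp
  show thesis
    by (rule that[OF k1(1) k2(1) j1 j2]) (simp add: hits_def)
qed

text \<open>The combined equation makes \<open>sum v X - T2\<close> a multiple of \<open>Q\<close>;
  being smaller than \<open>Q\<close> in absolute value, it is 0.\<close>

lemma combine_targets:
  fixes w v :: "'a \<Rightarrow> int"
  assumes "\<bar>sum v X - T2\<bar> < Q"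
  shows "(\<Sum>e\<in>X. w e * Q + v e) = T1 * Q + T2 \<longleftrightarrow> sum w X = T1 \<and> sum v X = T2"
proof
  assume "(\<Sum>e\<in>X. w e * Q + v e) = T1 * Q + T2"
  then have *: "sum v X - T2 = (T1 - sum w X) * Q"
    by (simp add: sum.distrib algebra_simps flip: sum_distrib_left)
  have "T1 - sum w X = 0"
  proof (rule ccontr)
    assume "T1 - sum w X \<noteq> 0"
    then have "1 * \<bar>Q\<bar> \<le> \<bar>T1 - sum w X\<bar> * \<bar>Q\<bar>" by (intro mult_right_mono) auto
    moreover have "\<bar>sum v X - T2\<bar> = \<bar>T1 - sum w X\<bar> * \<bar>Q\<bar>"
      by (simp add: * abs_mult)
    ultimately show False using assms by linarith
  qed
  then show "sum w X = T1 \<and> sum v X = T2" using * by simp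
qed (auto simp: sum.distrib sum_distrib_right)

section \<open>The Knapsack program\<close>

text \<open>Registers: 1 holds the number 1, 2 to 5 the parameters \<open>n\<close>, \<open>N\<close>, \<open>t\<close>, \<open>b\<close>, 6 the base \<open>Q\<close> that
  combines the two weight functions, 7 and 8 the values \<open>M\<close> and \<open>E\<close> of the address translation,
  9 the answer, 10 and 11 the scales, 12 and 13 the offsets \<open>j1\<close> and \<open>j2\<close>, 14 and 15 the loop tests of
  the scales, 16 the item that is being written. The subset sum program uses 30 and above.\<close>

definition query_start :: "instr list" where
  "query_start = [
     Arith 19 Plus 4 10, Arith 19 Minus 19 1, Arith 19 Div 19 10, Arith 19 Plus 19 12, Arith 19 Minus 19 1,
     Arith 20 Div 5 11, Arith 20 Minus 20 13, Arith 20 Plus 20 1,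
     Arith 17 Times 19 6, Arith 17 Plus 17 20,
     Arith 18 Times 3 6, Arith 18 Plus 18 3, Arith 18 Plus 18 17,
     Store 8 2, Arith 21 Plus 7 8, Store 21 18,
     Arith 22 Plus 1 1, Arith 21 Plus 2 22, Arith 21 Times 21 7, Arith 21 Plus 21 8, Store 21 17,
     Const 16 0, Arith 16 Plus 16 2]"

text \<open>Item \<open>e\<close> has its two weights in the input cells \<open>e + 1\<close> and
  \<open>e + 1 + n\<close>. Address \<open>e + 1\<close> is also its place in the new instance,
  since both encodings begin with two numbers.\<close>

definition write_weight :: "instr list" where
  "write_weight = [
     Arith 21 Plus 16 1, Load 22 21, Arith 22 Div 22 10, Arith 22 Times 22 6,
     Arith 23 Plus 21 2, Load 24 23, Arith 24 Plus 24 11, Arith 24 Minus 24 1, Arith 24 Div 24 11,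
     Arith 22 Plus 22 24,
     Arith 21 Times 21 7, Arith 21 Plus 21 8, Store 21 22, Arith 16 Minus 16 1]"

text \<open>Register 30 is register 0 of the simulated program and holds its answer. Advancing
  register 8 opens a fresh residue class.\<close>

definition query :: "com \<Rightarrow> com" where
  "query A = Seq (block query_start) (Seq (Loop 16 (block write_weight))
     (Seq (block (map (\<lambda>r. Const (r + 30) 0) [0..<written_below A])) (Seq (simulate A)
     (Seq (Cond 30 (Do (Const 9 1)) Skip) (block [Arith 8 Plus 8 1, Arith 13 Minus 13 1])))))"

definition offset2_loop :: "com \<Rightarrow> com" where
  "offset2_loop A = Seq (block [Const 13 0, Arith 13 Plus 13 2]) (Loop 13 (query A))"

definition offset1_loop :: "com \<Rightarrow> com" where
  "offset1_loop A = Seq (block [Const 12 0, Arith 12 Plus 12 2])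
     (Loop 12 (Seq (offset2_loop A) (block [Arith 12 Minus 12 1])))"

text \<open>Tests only ask for positivity, so a scale is compared with \<open>b\<close> through
  \<open>b - P2 + 1 > 0\<close>.\<close>

definition scale2_loop :: "com \<Rightarrow> com" where
  "scale2_loop A = Seq (block [Const 11 1, Arith 15 Minus 5 11, Arith 15 Plus 15 1])
     (Loop 15 (Seq (offset1_loop A) (block [Arith 11 Plus 11 11, Arith 15 Minus 5 11, Arith 15 Plus 15 1])))"

definition scale1_loop :: "com \<Rightarrow> com" where
  "scale1_loop A = Seq (block [Const 10 1, Arith 14 Minus 3 10, Arith 14 Plus 14 1])
     (Loop 14 (Seq (scale2_loop A) (block [Arith 10 Plus 10 10, Arith 14 Minus 3 10, Arith 14 Plus 14 1])))"

text \<open>\<open>Load 2 0\<close> relies on register 0 being 0 initially; register 1 is both the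
  constant 1 and the address of \<open>N\<close>.\<close>

definition load_input :: "instr list" where
  "load_input = [Const 1 1, Load 2 0, Load 3 1,
     Arith 19 Plus 2 2, Const 20 2, Arith 19 Plus 19 20, Load 4 19, Arith 19 Plus 19 1, Load 5 19,
     Arith 8 Plus 19 1,
     Arith 6 Times 2 3, Arith 6 Plus 6 2, Arith 6 Plus 6 5, Arith 6 Plus 6 1,
     Arith 7 Times 3 5, Arith 7 Times 7 5, Arith 7 Times 7 2, Arith 7 Times 7 2, Arith 7 Plus 7 8, Arith 7 Plus 7 1]"

text \<open>The search treats \<open>t > 0\<close> only. Otherwise the empty set decides, and
  \<open>b + 1\<close> is positive exactly if it is feasible.\<close>

definition knapsack_solver :: "com \<Rightarrow> com" where
  "knapsack_solver A = Seq (block load_input)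
     (Seq (Cond 4 (scale1_loop A) (block [Arith 9 Plus 5 1])) (Cond 9 (Do (Const 0 1)) (Do (Const 0 0))))"

text \<open>Address \<open>x\<close> of the \<open>E\<close>-th subset sum computation is kept in cell \<open>x * M + E\<close>. So every
  computation finds clean memory without any cleaning up, and the space it leaves behind is
  counted at most once for each of the polynomially many computations. As the input is in cells \<open>0\<close>
  to \<open>2 * n + 3\<close>, \<open>E\<close> starts at \<open>2 * n + 4\<close>. The factor \<open>b * b\<close> in \<open>M\<close> keeps \<open>M\<close> above \<open>E\<close> also when
  \<open>b\<close> is negative.\<close>

locale reduction =
  fixes A :: com and n N :: nat and w v :: "nat \<Rightarrow> nat" and t b :: int and Z TA SA :: nat
  assumes A: "decides A subset_sum"
    and wN: "\<And>e. e \<in> {1..n} \<Longrightarrow> w e \<in> {1..N}" and vN: "\<And>e. e \<in> {1..n} \<Longrightarrow> v e \<in> {1..N}"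
    and Z: "2 * n + 4 \<le> Z" "bits (int n) \<le> Z" "bits (int N) \<le> Z" "bits t \<le> Z" "bits b \<le> Z"
    and TA: "\<And>J \<tau> \<sigma> s. J \<in> instances subset_sum \<Longrightarrow> ss_n J = n \<Longrightarrow>
      input_size subset_sum J \<le> 2000 * Z * Z \<Longrightarrow> exec A (init (encoding subset_sum J)) \<tau> \<sigma> s \<Longrightarrow>
      \<tau> \<le> TA \<and> \<sigma> \<le> SA"
begin

definition "R = written_below A"
text \<open>In a query the rounded \<open>v\<close> sum up to a value between 0 and
  \<open>n * N\<close>, and their target lies between \<open>1 - n\<close> and \<open>b\<close>;
  \<open>Q\<close> exceeds every such difference.\<close>

definition "Q = int n * int N + int n + b + 1"
text \<open>There are \<open>floorlog 2 N * floorlog 2 (nat b) * n * n\<close> queries. Replacing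
  the logarithms by \<open>N\<close> and \<open>b * b\<close> avoids computing them, and the bit
  length of \<open>M\<close> stays linear in \<open>Z\<close>.\<close>

definition "M = int N * b * b * int n * int n + (2 * int n + 4) + 1"
text \<open>The unit of the cost estimates. The factor 20 makes room for \<open>Q\<close> and
  \<open>M\<close>; by \<open>linear_bounds\<close>, \<open>M\<close> has at most
  \<open>13 * Z\<close> bits.\<close>

definition "L = 20 * Z"

text \<open>Invariant between queries: \<open>B\<close> is the answer so far, \<open>E\<close> the
  next residue class, and all classes from \<open>E\<close> on are clean. The registers from 30 up
  to \<open>R + 29\<close> may hold remains of earlier runs.\<close>

definition core :: "int \<Rightarrow> bool \<Rightarrow> state \<Rightarrow> bool" where
  "core E B s \<longleftrightarrow> finite_support s \<and> regs s 1 = 1 \<and> regs s 2 = int n \<and> regs s 3 = int N \<and>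
     regs s 4 = t \<and> regs s 5 = b \<and> regs s 6 = Q \<and> regs s 7 = M \<and> regs s 8 = E \<and>
     regs s 9 = of_bool B \<and> regs s 29 = 0 \<and> (\<forall>r\<ge>R + 30. regs s r = 0) \<and>
     (\<forall>e\<in>{1..n}. mem s (int e + 1) = int (w e) \<and> mem s (int e + 1 + int n) = int (v e)) \<and>
     (\<forall>x. E \<le> x mod M \<longrightarrow> mem s x = 0)"

lemma L1: "1 \<le> L" using Z(1) by (simp add: L_def)

lemma bits_params:
  "bits (int n) \<le> 1 * L" "bits (int N) \<le> 1 * L" "bits t \<le> 1 * L" "bits b \<le> 1 * L"
  "bits Q \<le> 1 * L" "bits M \<le> 1 * L"
proof -
  have Z1: "1 \<le> Z" using Z(1) by simp
  have Z': "bits (int n) \<le> 1 * Z" "bits (int N) \<le> 1 * Z" "bits t \<le> 1 * Z" "bits b \<le> 1 * Z"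
    using Z by simp_all
  show "bits (int n) \<le> 1 * L" "bits (int N) \<le> 1 * L" "bits t \<le> 1 * L" "bits b \<le> 1 * L"
    using Z' by (auto simp: L_def)
  show "bits Q \<le> 1 * L" unfolding L_def Q_def
    \<comment> \<open>\<open>order_trans\<close> leaves the middle bound open. The rules compute it
      along the syntax of the term, and \<open>simp\<close> compares the resulting numerals.\<close>
    by (rule order_trans, ((rule linear_bounds[OF Z1] Z') | (simp; fail))+)
  show "bits M \<le> 1 * L" unfolding L_def M_def
    by (rule order_trans, ((rule linear_bounds[OF Z1] Z') | (simp; fail))+)
qed

lemma bits_le_L: "\<bar>x\<bar> \<le> \<bar>y\<bar> \<Longrightarrow> bits y \<le> i * L \<Longrightarrow> bits x \<le> i * L"
  using bits_mono order_trans by blast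

section \<open>The Subset Sum instance of one query\<close>

definition "target P1 P2 j1 j2 = (cdiv t P1 + j1 - 1) * Q + (b div P2 - j2 + 1)"
text \<open>An instance needs one number that bounds the weights and the target; adding both bounds
  spares the program a maximum.\<close>

definition "cap P1 P2 j1 j2 = int N * Q + int N + target P1 P2 j1 j2"
definition "weight P1 P2 e = int (w e) div P1 * Q + cdiv (int (v e)) P2"

definition sub_instance :: "int \<Rightarrow> int \<Rightarrow> int \<Rightarrow> int \<Rightarrow> subset_sum_instance" where
  "sub_instance P1 P2 j1 j2 = \<lparr>ss_n = n, ss_N = nat (cap P1 P2 j1 j2),
     ss_weight = (\<lambda>e. nat (weight P1 P2 e)), ss_t = target P1 P2 j1 j2\<rparr>"

abbreviation hit :: "int \<Rightarrow> int \<Rightarrow> int \<Rightarrow> int \<Rightarrow> bool" where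
  "hit P1 P2 j1 j2 \<equiv>
     (\<exists>X\<subseteq>{1..n}. hits (\<lambda>e. int (w e)) (\<lambda>e. int (v e)) t b P1 P2 j1 j2 X)"

context
  fixes P1 P2 j1 j2 :: int
  assumes P1: "1 \<le> P1" "P1 \<le> N" and P2: "1 \<le> P2" "P2 \<le> b"
    and j1: "1 \<le> j1" "j1 \<le> n" and j2: "1 \<le> j2" "j2 \<le> n" and t: "0 < t"
begin

lemma Q_pos: "0 < Q" using P2 by (simp add: Q_def)

lemma cdiv_v: "e \<in> {1..n} \<Longrightarrow> 1 \<le> cdiv (int (v e)) P2" "e \<in> {1..n} \<Longrightarrow> cdiv (int (v e)) P2 \<le> int N"
proof -
  assume e: "e \<in> {1..n}"
  show "1 \<le> cdiv (int (v e)) P2" using vN[OF e] P2 cdiv_le_iff[of P2 "int (v e)" 0] by simp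
  have "int (v e) * 1 \<le> int (v e) * P2" using P2 by (intro mult_left_mono) auto
  then have "cdiv (int (v e)) P2 \<le> int (v e)" using P2 by (simp add: cdiv_le_iff)
  then show "cdiv (int (v e)) P2 \<le> int N" using vN[OF e] by simp
qed

lemma weight_bounds: "e \<in> {1..n} \<Longrightarrow> 1 \<le> weight P1 P2 e" "e \<in> {1..n} \<Longrightarrow> weight P1 P2 e \<le> int N * Q + int N"
proof -
  assume e: "e \<in> {1..n}"
  have "0 \<le> int (w e) div P1" using P1 by (simp add: pos_imp_zdiv_nonneg_iff)
  then show "1 \<le> weight P1 P2 e"
    using Q_pos cdiv_v(1)[OF e] unfolding weight_def by (simp add: add_increasing)
  have "int (w e) div P1 \<le> int (w e) div 1" using P1 by (intro zdiv_mono2) auto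
  then have "int (w e) div P1 \<le> int N" using wN[OF e] by simp
  then have "int (w e) div P1 * Q \<le> int N * Q" using Q_pos by (intro mult_right_mono) auto
  then show "weight P1 P2 e \<le> int N * Q + int N"
    using cdiv_v(2)[OF e] unfolding weight_def by simp
qed

text \<open>The first target contributes at least \<open>Q\<close>, which outweighs the at most
  \<open>n - 1\<close> by which the second can fall below 0. Positivity is what makes
  \<open>cap\<close> a bound on the weights.\<close>

lemma target_pos: "0 < target P1 P2 j1 j2"
proof -
  have "1 \<le> cdiv t P1" using t P1 cdiv_le_iff[of P1 t 0] by simp
  then have "1 * Q \<le> (cdiv t P1 + j1 - 1) * Q" using j1 Q_pos by (intro mult_right_mono) auto
  moreover have "0 \<le> b div P2" using P2 by (simp add: pos_imp_zdiv_nonneg_iff)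
  moreover have "0 \<le> int n * int N" by simp
  moreover have "Q = int n * int N + int n + b + 1" by (rule Q_def)
  ultimately show ?thesis using j2 P2 unfolding target_def by linarith
qed

lemma cap_pos: "0 \<le> cap P1 P2 j1 j2" "target P1 P2 j1 j2 \<le> cap P1 P2 j1 j2"
  using Q_pos target_pos by (auto simp: cap_def)

lemma sub_instance: "sub_instance P1 P2 j1 j2 \<in> instances subset_sum"
  using weight_bounds target_pos cap_pos
  by (force simp: sub_instance_def subset_sum_def cap_def nat_le_iff le_nat_iff)

lemma accepted_sub_instance:
  "accepted subset_sum (sub_instance P1 P2 j1 j2) \<longleftrightarrow> hit P1 P2 j1 j2"
proof -
  have "int (\<Sum>e\<in>X. nat (weight P1 P2 e)) = target P1 P2 j1 j2 \<longleftrightarrow>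
      hits (\<lambda>e. int (w e)) (\<lambda>e. int (v e)) t b P1 P2 j1 j2 X" if X: "X \<subseteq> {1..n}" for X
  proof -
    have "int (\<Sum>e\<in>X. nat (weight P1 P2 e)) = (\<Sum>e\<in>X. weight P1 P2 e)"
      unfolding of_nat_sum using weight_bounds X by (intro sum.cong) force+
    moreover have "\<bar>(\<Sum>e\<in>X. cdiv (int (v e)) P2) - (b div P2 - j2 + 1)\<bar> < Q"
    proof -
      have "(\<Sum>e\<in>X. cdiv (int (v e)) P2) \<le> (\<Sum>e\<in>X. int N)" "0 \<le> (\<Sum>e\<in>X. cdiv (int (v e)) P2)"
        using cdiv_v X by (intro sum_mono sum_nonneg; force)+
      moreover have "(\<Sum>e\<in>X. int N) \<le> int n * int N"
        using card_mono[OF _ X] by (simp add: mult_right_mono)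
      moreover have "0 \<le> b div P2" "b div P2 \<le> b"
        using P2 zdiv_mono2[of b 1 P2] by (simp_all add: pos_imp_zdiv_nonneg_iff)
      ultimately show ?thesis using j2 P2 unfolding Q_def by linarith
    qed
    ultimately show ?thesis
      using combine_targets by (simp add: hits_def weight_def target_def)
  qed
  then show ?thesis by (auto simp: subset_sum_def sub_instance_def)
qed

lemma bits_sub:
  "bits P1 \<le> 1 * L" "bits P2 \<le> 1 * L" "bits j1 \<le> 1 * L" "bits j2 \<le> 1 * L"
  "bits (target P1 P2 j1 j2) \<le> 10 * L" "bits (cap P1 P2 j1 j2) \<le> 13 * L"
  "e \<in> {1..n} \<Longrightarrow> bits (weight P1 P2 e) \<le> 3 * L"
proof -
  show P: "bits P1 \<le> 1 * L" "bits P2 \<le> 1 * L" "bits j1 \<le> 1 * L" "bits j2 \<le> 1 * L"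
    using P1 P2 j1 j2
    by (rule_tac bits_le_L[OF _ bits_params(2)] bits_le_L[OF _ bits_params(4)]
        bits_le_L[OF _ bits_params(1)]; simp; fail)+
  note bs = linear_bounds[OF L1] P bits_params
  show T: "bits (target P1 P2 j1 j2) \<le> 10 * L" unfolding target_def cdiv_def
    by (rule order_trans, ((rule bs) | (simp; fail))+)
  show "bits (cap P1 P2 j1 j2) \<le> 13 * L" unfolding cap_def
    by (rule order_trans, ((rule bs T) | (simp; fail))+)
  assume "e \<in> {1..n}"
  then have "\<bar>weight P1 P2 e\<bar> \<le> \<bar>int N * Q + int N\<bar>" using weight_bounds by force
  moreover have "bits (int N * Q + int N) \<le> 3 * L"
    by (rule order_trans, ((rule bs T) | (simp; fail))+)
  ultimately show "bits (weight P1 P2 e) \<le> 3 * L" by (rule bits_le_L)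
qed

text \<open>Quadratic, as there are \<open>n\<close> weights of \<open>O(Z)\<close> bits each. The
  estimate yields \<open>120 * Z * Z\<close>; the constant 2000 is generous.\<close>

lemma input_size_sub_instance: "input_size subset_sum (sub_instance P1 P2 j1 j2) \<le> 2000 * Z * Z"
proof -
  have "(\<Sum>e\<leftarrow>[1..<Suc n]. bits (int (nat (weight P1 P2 e)))) \<le> (\<Sum>e\<leftarrow>[1..<Suc n]. 3 * L)"
  proof (rule sum_list_mono)
    fix e assume "e \<in> set [1..<Suc n]"
    then have "e \<in> {1..n}" by auto
    then show "bits (int (nat (weight P1 P2 e))) \<le> 3 * L"
      using weight_bounds(1)[of e] bits_sub(7)[of e] by simp
  qed
  also have "\<dots> = n * (3 * L)" by (simp add: sum_list_triv del: upt_Suc)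
  finally have "input_size subset_sum (sub_instance P1 P2 j1 j2)
      \<le> 1 * L + (13 * L + (n * (3 * L) + 10 * L))"
    using bits_sub(5,6) bits_params(1) cap_pos
    by (simp add: input_size_def subset_sum_def sub_instance_def o_def del: upt_Suc)
  also have "\<dots> = (24 + 3 * n) * L" by (simp add: algebra_simps)
  also have "\<dots> \<le> (6 * Z) * L" using Z(1) by (intro mult_right_mono) auto
  also have "\<dots> \<le> 2000 * Z * Z" by (simp add: L_def)
  finally show ?thesis .
qed

section \<open>Execution of one query\<close>

context
  fixes E :: int and B :: bool and s :: state
  assumes core: "core E B s" and E: "2 * int n + 4 \<le> E" "E < M"
    and regs_s: "regs s 10 = P1" "regs s 11 = P2" "regs s 12 = j1" "regs s 13 = j2"
begin

text \<open>Content of the residue class by address in the new instance. Items are written downwards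
  from \<open>n\<close>, so after \<open>k\<close> steps the last \<open>k\<close> weights are
  present.\<close>

definition cell :: "nat \<Rightarrow> int \<Rightarrow> int" where
  "cell k a = (if a = 0 then int n else if a = 1 then cap P1 P2 j1 j2
     else if a = int n + 2 then target P1 P2 j1 j2
     else if int n - int k + 1 < a \<and> a \<le> int n + 1 then weight P1 P2 (nat (a - 1)) else 0)"

definition written :: "nat \<Rightarrow> state \<Rightarrow> bool" where
  "written k u \<longleftrightarrow> finite_support u \<and> (\<forall>r\<in>{1..15}. regs u r = regs s r) \<and> regs u 29 = 0 \<and>
     (\<forall>r\<ge>R + 30. regs u r = 0) \<and> regs u 16 = int n - int k \<and>
     (\<forall>a. mem u (a * M + E) = cell k a) \<and> (\<forall>x. x mod M \<noteq> E \<longrightarrow> mem u x = mem s x)"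

lemma mod_E: "(a * M + E) mod M = E" using E by simp

lemma bits_E: "bits E \<le> 1 * L"
  using E by (intro bits_le_L[OF _ bits_params(6)]) auto

lemma cost_bounds:
  "bits E \<le> 1 * L" "bits P1 \<le> 1 * L" "bits P2 \<le> 1 * L" "bits j1 \<le> 1 * L" "bits j2 \<le> 1 * L"
  using bits_E bits_sub by auto

lemma address_eq: "a * M + E = E \<longleftrightarrow> a = 0" "a * M + E = M + E \<longleftrightarrow> a = 1"
    "a * M + E = c * M + E \<longleftrightarrow> a = c"
  using E by (auto simp: mult_cancel_right1)

lemma runs_query_start: "runs (block query_start) s (300 * L) (300 * L) (written 0)"
proof -
  note core = core[unfolded core_def]
  have cost: "block_cost query_start s \<le> 300 * L"
    using core regs_s apply (simp add: query_start_def)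
    by (rule order_trans, ((rule linear_bounds[OF L1] bits_params cost_bounds) | (simp; fail))+)
  let ?u = "block_result query_start s"
  have mem: "mem ?u = (mem s)(E := int n, M + E := cap P1 P2 j1 j2,
      (int n + 2) * M + E := target P1 P2 j1 j2)"
    using core regs_s by (simp add: query_start_def target_def cap_def cdiv_def)
  have regs: "regs ?u 16 = int n" "\<And>r. r \<notin> {16..24} \<Longrightarrow> regs ?u r = regs s r"
    using core regs_s by (auto simp: query_start_def)
  have m0: "mem s (a * M + E) = 0" for a
    using core E by simp
  have md: "E mod M = E" "(M + E) mod M = E" using mod_E[of 0] mod_E[of 1] by simp_all
  have "written 0 ?u" if "finite_support ?u"
    unfolding written_def
  proof (intro conjI allI ballI impI)
    show "mem ?u (a * M + E) = cell 0 a" for a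
      using m0[of a] E by (simp add: mem address_eq cell_def)
    show "mem ?u x = mem s x" if "x mod M \<noteq> E" for x
      using that md mod_E[of "int n + 2"] by (auto simp: mem)
  qed (use that regs core in auto)
  then show ?thesis
    using core by (intro runs_weaken[OF runs_block[OF _ cost]]) auto
qed

lemma runs_write_weight:
  assumes k: "k < n" and u: "written k u"
  shows "regs u 16 > 0 \<and> bits (regs u 16) \<le> L \<and>
    runs (block write_weight) u (100 * L) (100 * L) (written (Suc k))"
proof -
  note core = core[unfolded core_def] and u = u[unfolded written_def]
  define e where "e = n - k"
  have e: "e \<in> {1..n}" "int n - int k = int e" using k by (auto simp: e_def)
  have regs_u: "regs u 16 = int e" "regs u 1 = 1" "regs u 2 = int n" "regs u 6 = Q" "regs u 7 = M"
    "regs u 8 = E" "regs u 10 = P1" "regs u 11 = P2"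
    using u core regs_s e(2) by auto
  have "mem u x = mem s x" if "0 \<le> x" "x < 2 * int n + 4" for x
  proof -
    \<comment> \<open>Input cells lie below \<open>E\<close> and are their own residues, so the
      query does not overwrite them.\<close>
    have "x mod M \<noteq> E" using that E by simp
    then show ?thesis using u by simp
  qed
  then have mem_u: "mem u (int e + 1) = int (w e)" "mem u (int e + 1 + int n) = int (v e)"
    using core e by auto
  have be: "bits (int e) \<le> 1 * L"
    using e by (intro bits_le_L[OF _ bits_params(1)]) auto
  have wv: "bits (int (w e)) \<le> 1 * L" "bits (int (v e)) \<le> 1 * L"
    using wN[OF e(1)] vN[OF e(1)] by (intro bits_le_L[OF _ bits_params(2)]; simp)+
  have cost: "block_cost write_weight u \<le> 100 * L"
    using regs_u mem_u apply (simp add: write_weight_def)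
    by (rule order_trans, ((rule linear_bounds[OF L1] bits_params cost_bounds be wv) | (simp; fail))+)
  let ?u = "block_result write_weight u"
  have mem: "mem ?u = (mem u)((int e + 1) * M + E := weight P1 P2 e)"
    using regs_u mem_u by (simp add: write_weight_def weight_def cdiv_def)
  have regs: "regs ?u 16 = int e - 1" "\<And>r. r \<notin> {16..24} \<Longrightarrow> regs ?u r = regs u r"
    using regs_u by (auto simp: write_weight_def)
  have "written (Suc k) ?u" if "finite_support ?u"
    unfolding written_def
  proof (intro conjI allI ballI impI)
    show "mem ?u (a * M + E) = cell (Suc k) a" for a
    proof -
      have "mem u (a * M + E) = cell k a" using u by blast
      then have "mem ?u (a * M + E) = (if a = int e + 1 then weight P1 P2 e else cell k a)"
        unfolding mem fun_upd_apply address_eq by simp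
      also have "\<dots> = cell (Suc k) a" using e k by (auto simp: cell_def)
      finally show ?thesis .
    qed
    show "mem ?u x = mem s x" if "x mod M \<noteq> E" for x
      using that mod_E[of "int e + 1"] u by (auto simp: mem)
  qed (use that regs u k e in auto)
  then have "runs (block write_weight) u (100 * L) (100 * L) (written (Suc k))"
    using u by (intro runs_weaken[OF runs_block[OF _ cost]]) auto
  then show ?thesis using be e regs_u by auto
qed

lemma runs_write_weights:
  "written 0 u \<Longrightarrow> runs (Loop 16 (block write_weight)) u (n * (L + 100 * L) + L) (n * (100 * L)) (written n)"
  by (rule runs_Loop[where Inv = written]) (use runs_write_weight L1 in \<open>auto simp: written_def\<close>)

definition cleared :: "state \<Rightarrow> bool" where
  "cleared u \<longleftrightarrow> finite_support u \<and> (\<forall>r\<in>{1..15}. regs u r = regs s r) \<and>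
     (\<forall>r\<ge>29. regs u r = 0) \<and>
     (\<forall>a. mem u (a * M + E) = mem (init (encoding subset_sum (sub_instance P1 P2 j1 j2))) a) \<and>
     (\<forall>x. x mod M \<noteq> E \<longrightarrow> mem u x = mem s x)"

lemma cell_init: "cell n a = mem (init (encoding subset_sum (sub_instance P1 P2 j1 j2))) a"
proof -
  consider "a < 0 \<or> int n + 3 \<le> a" | "a = 0" | "a = 1" | "a = int n + 2"
    | e where "e \<in> {1..n}" "a = int e + 1"
  proof -
    have "\<exists>e\<in>{1..n}. a = int e + 1" if "2 \<le> a" "a \<le> int n + 1"
      using that by (intro bexI[of _ "nat (a - 1)"]) auto
    then show thesis using that by fastforce
  qed
  then show ?thesis
  proof cases
    case 1
    then show ?thesis
      by (auto simp: cell_def init_def subset_sum_def sub_instance_def simp del: upt_Suc)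
  next
    case 4
    then have "nat a = Suc (Suc n)" by simp
    then show ?thesis using 4
      by (simp add: cell_def init_def subset_sum_def sub_instance_def nth_append del: upt_Suc)
  next
    case (5 e)
    then have "nat a = Suc e" "e - 1 < n" "Suc (e - 1) = e" by auto
    moreover from this obtain e' where e': "e = Suc e'" by metis
    moreover have "nat (1 + int e') = Suc e'" by simp
    ultimately show ?thesis using 5 weight_bounds(1)[of e]
      by (simp add: cell_def init_def subset_sum_def sub_instance_def nth_append del: upt_Suc)
  qed (use cap_pos in \<open>simp_all add: cell_def init_def subset_sum_def sub_instance_def del: upt_Suc\<close>)
qed

text \<open>The invariant covers the registers from \<open>R + 30\<close> on, so clearing those
  below gives the zero registers that \<open>init\<close> demands.\<close>

lemma runs_clear:
  assumes "written n u"
  shows "runs (block (map (\<lambda>r. Const (r + 30) 0) [0..<written_below A])) u (R + 1) (R + 1) cleared"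
proof -
  have "r \<in> (\<lambda>r. r + 30) ` {0..<R} \<or> R + 30 \<le> r \<or> r = 29" if "29 \<le> r" for r
    using that by (auto simp: image_iff intro: bexI[of _ "r - 30"])
  then show ?thesis
    using assms
    by (intro runs_weaken[OF runs_block])
      (auto simp: block_cost_reset block_result_reset written_def cleared_def cell_init R_def)
qed

definition answered :: "bool \<Rightarrow> state \<Rightarrow> bool" where
  "answered C u \<longleftrightarrow> finite_support u \<and> (\<forall>r\<in>{1..15} - {9}. regs u r = regs s r) \<and>
     regs u 9 = of_bool C \<and> regs u 29 = 0 \<and> (\<forall>r\<ge>R + 30. regs u r = 0) \<and>
     (\<forall>x. x mod M \<noteq> E \<longrightarrow> mem u x = mem s x)"

lemma runs_simulate:
  assumes u: "cleared u"
  shows "runs (simulate A) u (10 * L * TA) (10 * L * (3 * SA + 2))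
    (\<lambda>u'. answered B u' \<and> regs u' 30 = of_bool (hit P1 P2 j1 j2))"
proof -
  note core = core[unfolded core_def] and u = u[unfolded cleared_def]
  let ?J = "sub_instance P1 P2 j1 j2"
  obtain \<tau> \<sigma> sA where A': "exec A (init (encoding subset_sum ?J)) \<tau> \<sigma> sA"
    "regs sA 0 = of_bool (hit P1 P2 j1 j2)"
    using A sub_instance accepted_sub_instance unfolding decides_def of_bool_def by metis
  have bound: "\<tau> \<le> TA" "\<sigma> \<le> SA"
    using TA[OF sub_instance _ input_size_sub_instance A'(1)] by (auto simp: sub_instance_def)
  have sim0: "simulates M E u (init (encoding subset_sum ?J)) u"
    using u by (auto simp: simulates_def init_finite_support) (simp add: init_def)
  have E0: "0 \<le> E" using E by simp
  have "regs u 7 = M" "regs u 8 = E" "finite_support u" using u core by auto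
  from simulate_exec[OF A'(1) sim0 E0 E(2) this] obtain \<tau>' \<sigma>' u' where
    ex: "exec (simulate A) u \<tau>' \<sigma>' u'" "\<tau>' \<le> (5 * bits M + 5) * \<tau>"
      "\<sigma>' \<le> state_size u + (5 * bits M + 5) * (3 * \<sigma> + 2)" and sim: "simulates M E u sA u'"
    by blast
  have k: "5 * bits M + 5 \<le> 10 * L" using bits_params(6) L1 by simp
  have "(5 * bits M + 5) * \<tau> \<le> 10 * L * TA" "(5 * bits M + 5) * (3 * \<sigma> + 2) \<le> 10 * L * (3 * SA + 2)"
    using bound k by (intro mult_mono; simp)+
  moreover have "answered B u'"
  proof -
    \<comment> \<open>The program cannot write these registers, so they still hold 0 for the next
      query.\<close>
    have "regs u' r = 0" if "R + 30 \<le> r" for r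
    proof -
      define q where "q = r - 30"
      then have q: "r = q + 30" "R \<le> q" using that by auto
      have "regs sA q = 0"
        using exec_written_below[OF A'(1), of q] q(2) by (simp add: R_def init_def)
      then show ?thesis using sim q(1) by (simp add: simulates_def)
    qed
    then show ?thesis using u sim core by (auto simp: answered_def simulates_def)
  qed
  moreover have "regs u' 30 = of_bool (hit P1 P2 j1 j2)"
    using sim A'(2) unfolding simulates_def by (metis add_0)
  ultimately show ?thesis
    unfolding runs_def using ex by (meson add_left_mono order_trans)
qed

lemma runs_answer:
  assumes u: "answered B u" "regs u 30 = of_bool H"
  shows "runs (Cond 30 (Do (Const 9 1)) Skip) u 2 1 (answered (B \<or> H))"
proof -
  have "runs (Do (Const 9 1)) u 1 1 (answered (B \<or> H))" if "0 < regs u 30"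
  proof (rule runs_weaken[OF runs_Do])
    show "answered (B \<or> H) s'" if "s' = instr_result (Const 9 1) u" for s'
      using that u \<open>0 < regs u 30\<close> instr_finite_support[of u "Const 9 1"]
      by (cases H) (auto simp: answered_def)
  qed (use u in \<open>auto simp: answered_def\<close>)
  moreover have "runs Skip u 1 1 (answered (B \<or> H))" if "\<not> 0 < regs u 30"
    using u that by (intro runs_Skip) (cases H; simp)
  ultimately have "runs (Cond 30 (Do (Const 9 1)) Skip) u (bits (regs u 30) + 1) 1 (answered (B \<or> H))"
    by (rule runs_Cond)
  moreover have "bits (regs u 30) = 1" using u(2) by (cases H) simp_all
  ultimately show ?thesis by (simp add: numeral_2_eq_2)
qed

lemma runs_next:
  assumes u: "answered C u"
  shows "runs (block [Arith 8 Plus 8 1, Arith 13 Minus 13 1]) u (10 * L) (10 * L)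
    (\<lambda>u'. core (E + 1) C u' \<and> regs u' 13 = j2 - 1 \<and> (\<forall>r\<in>{10, 11, 12, 14, 15}. regs u' r = regs s r))"
proof -
  note core = core[unfolded core_def] and u = u[unfolded answered_def]
  have regs_u: "regs u 8 = E" "regs u 1 = 1" "regs u 13 = j2" using u core regs_s by auto
  have cost: "block_cost [Arith 8 Plus 8 1, Arith 13 Minus 13 1] u \<le> 10 * L"
    using regs_u apply simp
    by (rule order_trans, ((rule linear_bounds[OF L1] cost_bounds) | (simp; fail))+)
  have inp: "mem u x = mem s x" if "0 \<le> x" "x < 2 * int n + 4" for x
  proof -
    have "x mod M \<noteq> E" using that E by simp
    then show ?thesis using u by simp
  qed
  have 1: "mem u x = 0" if "E + 1 \<le> x mod M" for x
    using that u core by simp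
  show ?thesis
    using u regs_u core inp 1
    by (intro runs_weaken[OF runs_block[OF _ cost]]) (auto simp: core_def)
qed

text \<open>\<open>10 * L\<close> bounds the simulation factor \<open>5 * bits M + 5\<close>; the
  rest of the query takes \<open>O(n)\<close> instructions on numbers of \<open>O(L)\<close> bits,
  besides the reset of \<open>R\<close> registers.\<close>

lemma runs_query:
  "runs (query A) s (500 * L * Z + R + 10 * L * TA) (500 * L * Z + R + 10 * L * (3 * SA + 2))
    (\<lambda>u. core (E + 1) (B \<or> hit P1 P2 j1 j2) u \<and> regs u 13 = j2 - 1 \<and>
       (\<forall>r\<in>{10, 11, 12, 14, 15}. regs u r = regs s r))"
proof -
  have "n * (L + 100 * L) + 4 * (101 * L) \<le> Z * (101 * L)"
    using mult_le_mono1[of "n + 4" Z "101 * L"] Z(1) by (simp add: algebra_simps)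
  moreover have "4 * L \<le> Z * L" using Z(1) by (intro mult_le_mono1) simp
  moreover have "4 \<le> L" using Z(1) by (simp add: L_def)
  ultimately have le: "300 * L + (n * (L + 100 * L) + L) + (R + 1) + 2 + 10 * L \<le> 500 * L * Z + R"
    by (simp add: algebra_simps)
  show ?thesis unfolding query_def
    by (rule runs_weaken[OF runs_Seq[OF runs_query_start runs_Seq[OF runs_write_weights
          runs_Seq[OF runs_clear runs_Seq[OF runs_simulate runs_Seq[OF runs_answer runs_next]]]]]])
      (use le in \<open>auto simp: algebra_simps\<close>)
qed

end

end

section \<open>The four nested search loops\<close>

lemma runs_core_loop:
  assumes step: "\<And>k E B u. k < K \<Longrightarrow> core E B u \<Longrightarrow> F k u \<Longrightarrow> 2 * int n + 4 \<le> E \<Longrightarrow> E + d \<le> M \<Longrightarrow>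
      regs u r > 0 \<and> bits (regs u r) \<le> 6 * L \<and>
      runs c u T D (\<lambda>u'. core (E + d) (B \<or> H k) u' \<and> F (Suc k) u')"
    and stop: "\<And>u. F K u \<Longrightarrow> regs u r \<le> 0 \<and> bits (regs u r) \<le> 6 * L"
    and start: "core E B u" "F 0 u" "2 * int n + 4 \<le> E" "E + int K * d \<le> M" "0 \<le> d"
  shows "runs (Loop r c) u (K * (6 * L + T) + 6 * L) (K * D)
    (\<lambda>u'. core (E + int K * d) (B \<or> (\<exists>k<K. H k)) u' \<and> F K u')"
\<comment> \<open>\<open>d\<close> is the number of residue classes used up by one iteration;
  \<open>E + int K * d \<le> M\<close> ensures that they do not run out.\<close>
proof (rule runs_Loop[where Inv = "\<lambda>k u'. core (E + int k * d) (B \<or> (\<exists>i<k. H i)) u' \<and> F k u'"])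
  fix k u' assume k: "k < K" and Inv: "core (E + int k * d) (B \<or> (\<exists>i<k. H i)) u' \<and> F k u'"
  have "(int k + 1) * d \<le> int K * d" "0 \<le> int k * d" using k start(5) by (auto intro: mult_right_mono)
  moreover have "(int k + 1) * d = int k * d + d" by (simp add: distrib_right)
  ultimately have "2 * int n + 4 \<le> E + int k * d" "E + int k * d + d \<le> M"
    using start(3,4) by linarith+
  from step[OF k _ _ this] Inv
  have "regs u' r > 0 \<and> bits (regs u' r) \<le> 6 * L \<and>
    runs c u' T D (\<lambda>u'. core (E + int k * d + d) ((B \<or> (\<exists>i<k. H i)) \<or> H k) u' \<and> F (Suc k) u')"
    by blast
  moreover have "(B \<or> (\<exists>i<k. H i)) \<or> H k \<longleftrightarrow> B \<or> (\<exists>i<Suc k. H i)"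
    using less_Suc_eq by auto
  moreover have "E + int k * d + d = E + int (Suc k) * d" by (simp add: algebra_simps)
  ultimately show "regs u' r > 0 \<and> bits (regs u' r) \<le> 6 * L \<and>
      runs c u' T D (\<lambda>u'. core (E + int (Suc k) * d) (B \<or> (\<exists>i<Suc k. H i)) u' \<and> F (Suc k) u')"
    by simp
qed (use start stop in auto)

text \<open>The cost of a loop with at most \<open>Z\<close> iterations of a body of cost \<open>X\<close>.\<close>

definition "loop_bound X = 20 * L + Z * (40 * L + X)"

text \<open>\<open>14 * L\<close> pays for setting up a loop, \<open>6 * L\<close> for a test and
  \<open>30 * L\<close> for updating the counter or scale.\<close>

lemma loop_bound: "K \<le> Z \<Longrightarrow> 14 * L + (K * (6 * L + (X + 30 * L)) + 6 * L) \<le> loop_bound X"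
    "K \<le> Z \<Longrightarrow> 14 * L + K * (X + 30 * L) \<le> loop_bound X"
proof -
  assume "K \<le> Z"
  then have "K * (6 * L + (X + 30 * L)) \<le> Z * (40 * L + X)" "K * (X + 30 * L) \<le> Z * (40 * L + X)"
    by (intro mult_mono; simp)+
  then show "14 * L + (K * (6 * L + (X + 30 * L)) + 6 * L) \<le> loop_bound X" "14 * L + K * (X + 30 * L) \<le> loop_bound X"
    by (simp_all add: loop_bound_def)
qed

definition "TQ = 500 * L * Z + R + 10 * L * TA"
definition "DQ = 500 * L * Z + R + 10 * L * (3 * SA + 2)"

text \<open>Offsets have the form \<open>int n - int k\<close> because their registers count down
  from \<open>n\<close> to 1.\<close>

definition "hit3 P1 P2 j1 \<longleftrightarrow> (\<exists>k<n. hit P1 P2 j1 (int n - int k))"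
definition "hit2 P1 P2 \<longleftrightarrow> (\<exists>k<n. hit3 P1 P2 (int n - int k))"
definition "hit1 P1 \<longleftrightarrow> (\<exists>k<floorlog 2 (nat b). hit2 P1 (2 ^ k))"

lemma bits_n_minus: "k \<le> n \<Longrightarrow> bits (int n - int k) \<le> 1 * L"
  by (intro bits_le_L[OF _ bits_params(1)]) auto

lemma runs_offset2_loop:
  fixes P1 P2 j1 :: int
  assumes P1: "1 \<le> P1" "P1 \<le> N" and P2: "1 \<le> P2" "P2 \<le> b" and j1: "1 \<le> j1" "j1 \<le> n" and t: "0 < t"
    and core: "core E B s" and E: "2 * int n + 4 \<le> E" "E + int n \<le> M"
    and regs: "regs s 10 = P1" "regs s 11 = P2" "regs s 12 = j1"
  shows "runs (offset2_loop A) s (loop_bound TQ) (loop_bound DQ) (\<lambda>u.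
    core (E + int n) (B \<or> hit3 P1 P2 j1) u \<and> (\<forall>r\<in>{10, 11, 12, 14, 15}. regs u r = regs s r))"
proof -
  let ?F = "\<lambda>k u. regs u 13 = int n - int k \<and> (\<forall>r\<in>{10, 11, 12, 14, 15}. regs u r = regs s r)"
  have cost: "block_cost [Const 13 0, Arith 13 Plus 13 2] s \<le> 14 * L"
    using core apply (simp add: core_def)
    by (rule order_trans, ((rule linear_bounds[OF L1] bits_params) | (simp; fail))+)
  have head: "runs (block [Const 13 0, Arith 13 Plus 13 2]) s (14 * L) (14 * L) (\<lambda>u. core E B u \<and> ?F 0 u)"
    using core by (intro runs_weaken[OF runs_block[OF _ cost]]) (auto simp: core_def)
  have "runs (Loop 13 (query A)) u (n * (6 * L + TQ) + 6 * L) (n * DQ)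
      (\<lambda>u'. core (E + int n * 1) (B \<or> hit3 P1 P2 j1) u' \<and> ?F n u')" if u: "core E B u \<and> ?F 0 u" for u
    unfolding hit3_def
  proof (rule runs_core_loop[where K = n and d = 1 and F = ?F and H = "\<lambda>k. hit P1 P2 j1 (int n - int k)"])
    fix k E B u assume k: "k < n" and c: "core E B u" and F: "?F k u"
      and E: "2 * int n + 4 \<le> E" "E + 1 \<le> M"
    have j: "1 \<le> int n - int k" "int n - int k \<le> int n" using k by auto
    have regs': "regs u 10 = P1" "regs u 11 = P2" "regs u 12 = j1" "regs u 13 = int n - int k"
      using F regs by auto
    have "runs (query A) u TQ DQ (\<lambda>u'. core (E + 1) (B \<or> hit P1 P2 j1 (int n - int k)) u' \<and> ?F (Suc k) u')"
      unfolding TQ_def DQ_def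
      by (rule runs_weaken[OF runs_query[OF P1 P2 j1 j t c E(1) _ regs']]) (use E F in auto)
    then show "regs u 13 > 0 \<and> bits (regs u 13) \<le> 6 * L \<and>
        runs (query A) u TQ DQ (\<lambda>u'. core (E + 1) (B \<or> hit P1 P2 j1 (int n - int k)) u' \<and> ?F (Suc k) u')"
      using k regs' bits_n_minus[of k] by auto
  qed (use u E bits_n_minus[of n] in auto)
  then show ?thesis unfolding offset2_loop_def
    by (rule runs_weaken[OF runs_Seq[OF head]])
      (use loop_bound[of n TQ] loop_bound[of n DQ] Z(1) in \<open>auto simp: algebra_simps\<close>)
qed

lemma runs_offset1_loop:
  fixes P1 P2 :: int
  assumes P1: "1 \<le> P1" "P1 \<le> N" and P2: "1 \<le> P2" "P2 \<le> b" and t: "0 < t"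
    and core: "core E B s" and E: "2 * int n + 4 \<le> E" "E + int n * int n \<le> M"
    and regs: "regs s 10 = P1" "regs s 11 = P2"
  shows "runs (offset1_loop A) s (loop_bound (loop_bound TQ)) (loop_bound (loop_bound DQ)) (\<lambda>u.
    core (E + int n * int n) (B \<or> hit2 P1 P2) u \<and> (\<forall>r\<in>{10, 11, 14, 15}. regs u r = regs s r))"
proof -
  let ?F = "\<lambda>k u. regs u 12 = int n - int k \<and> (\<forall>r\<in>{10, 11, 14, 15}. regs u r = regs s r)"
  let ?c = "Seq (offset2_loop A) (block [Arith 12 Minus 12 1])"
  have cost: "block_cost [Const 12 0, Arith 12 Plus 12 2] s \<le> 14 * L"
    using core apply (simp add: core_def)
    by (rule order_trans, ((rule linear_bounds[OF L1] bits_params) | (simp; fail))+)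
  have head: "runs (block [Const 12 0, Arith 12 Plus 12 2]) s (14 * L) (14 * L) (\<lambda>u. core E B u \<and> ?F 0 u)"
    using core by (intro runs_weaken[OF runs_block[OF _ cost]]) (auto simp: core_def)
  have "runs (Loop 12 ?c) u (n * (6 * L + (loop_bound TQ + 30 * L)) + 6 * L) (n * (loop_bound DQ + 30 * L))
      (\<lambda>u'. core (E + int n * int n) (B \<or> hit2 P1 P2) u' \<and> ?F n u')" if u: "core E B u \<and> ?F 0 u" for u
    unfolding hit2_def
  proof (rule runs_core_loop[where K = n and d = "int n" and F = ?F and H = "\<lambda>k. hit3 P1 P2 (int n - int k)"])
    fix k E B u assume k: "k < n" and c: "core E B u" and F: "?F k u"
      and E: "2 * int n + 4 \<le> E" "E + int n \<le> M"
    have j: "1 \<le> int n - int k" "int n - int k \<le> int n" using k by auto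
    have regs': "regs u 10 = P1" "regs u 11 = P2" "regs u 12 = int n - int k"
      using F regs by auto
    let ?P = "\<lambda>u'. core (E + int n) (B \<or> hit3 P1 P2 (int n - int k)) u' \<and>
      (\<forall>r\<in>{10, 11, 12, 14, 15}. regs u' r = regs u r)"
    have "runs (block [Arith 12 Minus 12 1]) v (30 * L) (30 * L)
        (\<lambda>u'. core (E + int n) (B \<or> hit3 P1 P2 (int n - int k)) u' \<and> ?F (Suc k) u')" if v: "?P v" for v
    proof -
      have "block_cost [Arith 12 Minus 12 1] v \<le> 30 * L"
        using v regs' apply (simp add: core_def)
        by (rule order_trans, ((rule linear_bounds[OF L1] bits_n_minus[OF less_imp_le[OF k]]) | (simp; fail))+)
      then show ?thesis using v F
        by (intro runs_weaken[OF runs_block]) (auto simp: core_def)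
    qed
    from runs_Seq[OF runs_offset2_loop[OF P1 P2 j t c E regs'] this]
    show "regs u 12 > 0 \<and> bits (regs u 12) \<le> 6 * L \<and> runs ?c u (loop_bound TQ + 30 * L) (loop_bound DQ + 30 * L)
        (\<lambda>u'. core (E + int n) (B \<or> hit3 P1 P2 (int n - int k)) u' \<and> ?F (Suc k) u')"
      using k regs' bits_n_minus[of k] by auto
  qed (use u E bits_n_minus[of n] in auto)
  then show ?thesis unfolding offset1_loop_def
    by (rule runs_weaken[OF runs_Seq[OF head]])
      (use loop_bound[of n "loop_bound TQ"] loop_bound[of n "loop_bound DQ"] Z(1) in \<open>auto simp: algebra_simps\<close>)
qed

text \<open>The scale is doubled once more after its last use, so it can reach twice the bound. This
  is the origin of \<open>6 * L\<close> for loop tests.\<close>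

lemma bits_scale:
  assumes "k \<le> floorlog 2 (nat x)" "bits x \<le> 1 * L"
  shows "bits (2 ^ k) \<le> 4 * L" "bits (x - 2 ^ k + 1) \<le> 6 * L"
proof -
  have "(2::int) ^ k \<le> 2 ^ floorlog 2 (nat x)" using assms(1) by simp
  then have "(2::int) ^ k \<le> 2 * int (nat x) + 1" using two_power_floorlog[of "nat x"] by linarith
  moreover have "int (nat x) \<le> \<bar>x\<bar>" by simp
  moreover have "(0::int) \<le> 2 ^ k" by simp
  ultimately have *: "\<bar>2 ^ k\<bar> \<le> \<bar>2 * \<bar>x\<bar> + 1\<bar>" by linarith
  have "bits \<bar>x\<bar> \<le> 1 * L" using assms(2) by (simp add: bits_def)
  then have "bits (2 * \<bar>x\<bar> + 1) \<le> 4 * L"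
    by - (rule order_trans, ((rule linear_bounds[OF L1] | assumption) | (simp; fail))+)
  then show 1: "bits (2 ^ k) \<le> 4 * L" by (rule bits_le_L[OF *])
  show "bits (x - 2 ^ k + 1) \<le> 6 * L"
    by (rule order_trans, ((rule linear_bounds[OF L1] assms(2) 1) | (simp; fail))+)
qed

lemma runs_scale2_loop:
  fixes P1 :: int
  assumes P1: "1 \<le> P1" "P1 \<le> N" and t: "0 < t" and core: "core E B s" and E: "2 * int n + 4 \<le> E"
    and EM: "E + floorlog 2 (nat b) * (int n * int n) \<le> M"
    and regs: "regs s 10 = P1"
  shows "runs (scale2_loop A) s (loop_bound (loop_bound (loop_bound TQ))) (loop_bound (loop_bound (loop_bound DQ))) (\<lambda>u.
    core (E + floorlog 2 (nat b) * (int n * int n)) (B \<or> hit1 P1) u \<and> (\<forall>r\<in>{10, 14}. regs u r = regs s r))"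
proof -
  let ?K = "floorlog 2 (nat b)" and ?T = "loop_bound (loop_bound TQ)" and ?D = "loop_bound (loop_bound DQ)"
  let ?F = "\<lambda>k u. k \<le> ?K \<and> regs u 11 = 2 ^ k \<and> regs u 15 = b - 2 ^ k + 1 \<and> (\<forall>r\<in>{10, 14}. regs u r = regs s r)"
  let ?c = "Seq (offset1_loop A) (block [Arith 11 Plus 11 11, Arith 15 Minus 5 11, Arith 15 Plus 15 1])"
  \<comment> \<open>For \<open>b \<le> 0\<close> both sides are false, so the loop is skipped
    without a special case.\<close>
  have K: "k < ?K \<longleftrightarrow> 2 ^ k \<le> b" for k
  proof -
    have "(0::int) < 2 ^ k" by simp
    then show ?thesis using floorlog_2_less_iff[of k "nat b"] by linarith
  qed
  have cost: "block_cost [Const 11 1, Arith 15 Minus 5 11, Arith 15 Plus 15 1] s \<le> 14 * L"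
    using core apply (simp add: core_def)
    by (rule order_trans, ((rule linear_bounds[OF L1] bits_params) | (simp; fail))+)
  have head: "runs (block [Const 11 1, Arith 15 Minus 5 11, Arith 15 Plus 15 1]) s (14 * L) (14 * L)
      (\<lambda>u. core E B u \<and> ?F 0 u)"
    using core by (intro runs_weaken[OF runs_block[OF _ cost]]) (auto simp: core_def)
  have loop: "runs (Loop 15 ?c) u (?K * (6 * L + (?T + 30 * L)) + 6 * L) (?K * (?D + 30 * L))
      (\<lambda>u'. core (E + ?K * (int n * int n)) (B \<or> hit1 P1) u' \<and> ?F ?K u')" if u: "core E B u \<and> ?F 0 u" for u
    unfolding hit1_def
  proof (rule runs_core_loop[where K = ?K and d = "int n * int n" and F = ?F and H = "\<lambda>k. hit2 P1 (2 ^ k)"])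
    fix k E B u assume k: "k < ?K" and c: "core E B u" and F: "?F k u"
      and E: "2 * int n + 4 \<le> E" "E + int n * int n \<le> M"
    have P2: "1 \<le> (2::int) ^ k" "2 ^ k \<le> b" using k K by auto
    have regs': "regs u 10 = P1" "regs u 11 = 2 ^ k" "regs u 15 = b - 2 ^ k + 1"
      using F regs by auto
    note bk = bits_scale[OF less_imp_le[OF k] bits_params(4)]
    let ?P = "\<lambda>u'. core (E + int n * int n) (B \<or> hit2 P1 (2 ^ k)) u' \<and>
      (\<forall>r\<in>{10, 11, 14, 15}. regs u' r = regs u r)"
    have "runs (block [Arith 11 Plus 11 11, Arith 15 Minus 5 11, Arith 15 Plus 15 1]) v (30 * L) (30 * L)
        (\<lambda>u'. core (E + int n * int n) (B \<or> hit2 P1 (2 ^ k)) u' \<and> ?F (Suc k) u')" if v: "?P v" for v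
    proof -
      have "block_cost [Arith 11 Plus 11 11, Arith 15 Minus 5 11, Arith 15 Plus 15 1] v \<le> 30 * L"
        using v regs' apply (simp add: core_def)
        by (rule order_trans, ((rule linear_bounds[OF L1] bits_params bk) | (simp; fail))+)
      then show ?thesis using v F k regs'
        by (intro runs_weaken[OF runs_block]) (auto simp: core_def)
    qed
    from runs_Seq[OF runs_offset1_loop[OF P1 P2 t c E regs'(1,2)] this]
    show "regs u 15 > 0 \<and> bits (regs u 15) \<le> 6 * L \<and> runs ?c u (?T + 30 * L) (?D + 30 * L)
        (\<lambda>u'. core (E + int n * int n) (B \<or> hit2 P1 (2 ^ k)) u' \<and> ?F (Suc k) u')"
      using regs' P2 bk by auto
  next
    fix u assume "?F ?K u"
    then show "regs u 15 \<le> 0 \<and> bits (regs u 15) \<le> 6 * L"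
      using K[of ?K] bits_scale(2)[OF _ bits_params(4), of ?K] by auto
  qed (use u E EM in auto)
  have "?K \<le> Z" using floorlog_le_bits[of b] Z(5) by linarith
  then show ?thesis unfolding scale2_loop_def
    by (intro runs_weaken[OF runs_Seq[OF head loop]])
      (use loop_bound[of ?K ?T] loop_bound[of ?K ?D] in \<open>auto simp: algebra_simps\<close>)
qed

lemma runs_scale1_loop:
  assumes t: "0 < t" and core: "core E B s" and E: "2 * int n + 4 \<le> E"
    and EM: "E + floorlog 2 N * (floorlog 2 (nat b) * (int n * int n)) \<le> M"
  shows "runs (scale1_loop A) s (loop_bound (loop_bound (loop_bound (loop_bound TQ)))) (loop_bound (loop_bound (loop_bound (loop_bound DQ)))) (\<lambda>u.
    core (E + floorlog 2 N * (floorlog 2 (nat b) * (int n * int n))) (B \<or> (\<exists>k<floorlog 2 N. hit1 (2 ^ k))) u)"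
proof -
  let ?K = "floorlog 2 N" and ?T = "loop_bound (loop_bound (loop_bound TQ))" and ?D = "loop_bound (loop_bound (loop_bound DQ))"
  let ?d = "floorlog 2 (nat b) * (int n * int n)"
  let ?F = "\<lambda>k u. k \<le> ?K \<and> regs u 10 = 2 ^ k \<and> regs u 14 = int N - 2 ^ k + 1"
  let ?c = "Seq (scale2_loop A) (block [Arith 10 Plus 10 10, Arith 14 Minus 3 10, Arith 14 Plus 14 1])"
  have cost: "block_cost [Const 10 1, Arith 14 Minus 3 10, Arith 14 Plus 14 1] s \<le> 14 * L"
    using core apply (simp add: core_def)
    by (rule order_trans, ((rule linear_bounds[OF L1] bits_params) | (simp; fail))+)
  have head: "runs (block [Const 10 1, Arith 14 Minus 3 10, Arith 14 Plus 14 1]) s (14 * L) (14 * L)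
      (\<lambda>u. core E B u \<and> ?F 0 u)"
    using core by (intro runs_weaken[OF runs_block[OF _ cost]]) (auto simp: core_def)
  have loop: "runs (Loop 14 ?c) u (?K * (6 * L + (?T + 30 * L)) + 6 * L) (?K * (?D + 30 * L))
      (\<lambda>u'. core (E + ?K * ?d) (B \<or> (\<exists>k<?K. hit1 (2 ^ k))) u' \<and> ?F ?K u')" if u: "core E B u \<and> ?F 0 u" for u
  proof (rule runs_core_loop[where K = ?K and d = ?d and F = ?F and H = "\<lambda>k. hit1 (2 ^ k)"])
    fix k E B u assume k: "k < ?K" and c: "core E B u" and F: "?F k u"
      and E: "2 * int n + 4 \<le> E" "E + ?d \<le> M"
    have P1: "1 \<le> (2::int) ^ k" "2 ^ k \<le> int N" using k floorlog_2_less_iff by auto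
    have regs': "regs u 10 = 2 ^ k" "regs u 14 = int N - 2 ^ k + 1" using F by auto
    have "k \<le> floorlog 2 (nat (int N))" using k by simp
    note bk = bits_scale[OF this bits_params(2)]
    let ?P = "\<lambda>u'. core (E + ?d) (B \<or> hit1 (2 ^ k)) u' \<and> (\<forall>r\<in>{10, 14}. regs u' r = regs u r)"
    have "runs (block [Arith 10 Plus 10 10, Arith 14 Minus 3 10, Arith 14 Plus 14 1]) v (30 * L) (30 * L)
        (\<lambda>u'. core (E + ?d) (B \<or> hit1 (2 ^ k)) u' \<and> ?F (Suc k) u')" if v: "?P v" for v
    proof -
      have "block_cost [Arith 10 Plus 10 10, Arith 14 Minus 3 10, Arith 14 Plus 14 1] v \<le> 30 * L"
        using v regs' apply (simp add: core_def)
        by (rule order_trans, ((rule linear_bounds[OF L1] bits_params bk) | (simp; fail))+)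
      then show ?thesis using v F k regs'
        by (intro runs_weaken[OF runs_block]) (auto simp: core_def)
    qed
    from runs_Seq[OF runs_scale2_loop[OF P1 t c E regs'(1)] this]
    show "regs u 14 > 0 \<and> bits (regs u 14) \<le> 6 * L \<and> runs ?c u (?T + 30 * L) (?D + 30 * L)
        (\<lambda>u'. core (E + ?d) (B \<or> hit1 (2 ^ k)) u' \<and> ?F (Suc k) u')"
      using regs' P1 bk by auto
  next
    fix u assume "?F ?K u"
    then have "regs u 14 = int N - 2 ^ ?K + 1" by blast
    moreover have "int N - 2 ^ ?K + 1 \<le> 0" using floorlog_2_less_iff[of ?K N] by linarith
    moreover have "bits (int N - 2 ^ ?K + 1) \<le> 6 * L"
      using bits_scale(2)[OF _ bits_params(2), of ?K] by simp
    ultimately show "regs u 14 \<le> 0 \<and> bits (regs u 14) \<le> 6 * L" by metis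
  qed (use u E EM in auto)
  have "?K \<le> Z" using floorlog_le_bits[of "int N"] Z(3) by simp
  then show ?thesis unfolding scale1_loop_def
    by (intro runs_weaken[OF runs_Seq[OF head loop]])
      (use loop_bound[of ?K ?T] loop_bound[of ?K ?D] in \<open>auto simp: algebra_simps\<close>)
qed

section \<open>Enough residue classes, and correctness of the search\<close>

lemma epoch_bound: "2 * int n + 4 + floorlog 2 N * (floorlog 2 (nat b) * (int n * int n)) \<le> M"
proof -
  have "int (floorlog 2 (nat b)) \<le> b * b"
  proof (cases "0 < b")
    case True
    then have "b * 1 \<le> b * b" by (intro mult_left_mono) auto
    then show ?thesis using floorlog_2_le[of "nat b"] True by linarith
  qed (simp add: floorlog_def)
  then have "int (floorlog 2 N) * (floorlog 2 (nat b) * (int n * int n)) \<le> int N * (b * b * (int n * int n))"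
    using floorlog_2_le[of N] by (intro mult_mono) auto
  then show ?thesis by (simp add: M_def algebra_simps)
qed

definition "solvable \<longleftrightarrow> (\<exists>X\<subseteq>{1..n}. int (\<Sum>e\<in>X. v e) \<le> b \<and> int (\<Sum>e\<in>X. w e) \<ge> t)"

lemma exists_hit:
  assumes t: "0 < t"
  shows "(\<exists>k<floorlog 2 N. hit1 (2 ^ k)) \<longleftrightarrow> solvable"
proof
  assume "\<exists>k<floorlog 2 N. hit1 (2 ^ k)"
  then obtain k1 k2 k3 k4 X where k: "k3 < n" "k4 < n" and X: "X \<subseteq> {1..n}"
    and h: "hits (\<lambda>e. int (w e)) (\<lambda>e. int (v e)) t b (2 ^ k1) (2 ^ k2) (int n - int k3) (int n - int k4) X"
    unfolding hit1_def hit2_def hit3_def by blast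
  have "t \<le> (\<Sum>e\<in>X. int (w e))" "(\<Sum>e\<in>X. int (v e)) \<le> b"
    by (rule hits_sound[OF h]; use k in simp)+
  then show solvable using X unfolding solvable_def by auto
next
  assume solvable
  then obtain X where X: "X \<subseteq> {1..n}" "t \<le> (\<Sum>e\<in>X. int (w e))" "(\<Sum>e\<in>X. int (v e)) \<le> b"
    unfolding solvable_def of_nat_sum by blast
  \<comment> \<open>Scales up to \<open>N\<close> and \<open>b\<close> suffice: the first powers of
    2 beyond them serve as the limits in \<open>hits_complete\<close>.\<close>
  have N: "int N < 2 ^ floorlog 2 N"
    using floorlog_2_less_iff[of "floorlog 2 N" N] by linarith
  have b: "b < 2 ^ floorlog 2 (nat b)"
    using floorlog_2_less_iff[of "floorlog 2 (nat b)" "nat b"] by linarith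
  have pos: "0 < int (v e)" and W: "0 \<le> int (w e) \<and> int (w e) < 2 ^ floorlog 2 N" if "e \<in> X" for e
  proof -
    have e: "e \<in> {1..n}" using that X(1) by blast
    show "0 < int (v e)" using vN[OF e] by simp
    have "int (w e) \<le> int N" using wN[OF e] by simp
    then show "0 \<le> int (w e) \<and> int (w e) < 2 ^ floorlog 2 N" using N by linarith
  qed
  obtain k1 k2 j1 j2 where k: "k1 < floorlog 2 N" "k2 < floorlog 2 (nat b)"
    and j: "j1 \<in> {1..int n}" "j2 \<in> {1..int n}"
    and h: "hits (\<lambda>e. int (w e)) (\<lambda>e. int (v e)) t b (2 ^ k1) (2 ^ k2) j1 j2 X"
    by (rule hits_complete[OF X(1) t X(2,3) pos W b])
  have "\<exists>k<n. j = int n - int k" if "j \<in> {1..int n}" for j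
    using that by (intro exI[of _ "n - nat j"]) auto
  from this[OF j(1)] this[OF j(2)] show "\<exists>k<floorlog 2 N. hit1 (2 ^ k)"
    unfolding hit1_def hit2_def hit3_def using k h X(1) by blast
qed

lemma solvable_nonpos: "t \<le> 0 \<Longrightarrow> solvable \<longleftrightarrow> 0 \<le> b"
proof
  assume "t \<le> 0" "0 \<le> b"
  then show solvable unfolding solvable_def by (intro exI[of _ "{}"]) auto
next
  assume solvable
  then obtain X where "int (\<Sum>e\<in>X. v e) \<le> b" unfolding solvable_def by blast
  then show "0 \<le> b" using of_nat_0_le_iff order_trans by blast
qed

lemma runs_knapsack_solver:
  assumes s: "regs s = (\<lambda>_. 0)" "finite_support s" "mem s 0 = int n" "mem s 1 = int N"
    "mem s (2 * int n + 2) = t" "mem s (2 * int n + 3) = b"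
    "\<And>e. e \<in> {1..n} \<Longrightarrow> mem s (int e + 1) = int (w e)"
    "\<And>e. e \<in> {1..n} \<Longrightarrow> mem s (int e + 1 + int n) = int (v e)"
    "\<And>x. mem s x \<noteq> 0 \<Longrightarrow> 0 \<le> x \<and> x < 2 * int n + 4"
  shows "runs (knapsack_solver A) s (loop_bound (loop_bound (loop_bound (loop_bound TQ))) + 200 * L)
    (loop_bound (loop_bound (loop_bound (loop_bound DQ))) + 200 * L) (\<lambda>u. regs u 0 = of_bool solvable)"
proof -
  let ?T = "loop_bound (loop_bound (loop_bound (loop_bound TQ)))" and ?D = "loop_bound (loop_bound (loop_bound (loop_bound DQ)))"
  have cost: "block_cost load_input s \<le> 150 * L"
    using s(1,3-6) apply (simp add: load_input_def algebra_simps)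
    by (rule order_trans, ((rule linear_bounds[OF L1] bits_params) | (simp; fail))+)
  have regs: "regs (block_result load_input s) = (\<lambda>_. 0)(1 := 1, 2 := int n, 3 := int N, 19 := 2 * int n + 3,
      20 := 2, 4 := t, 5 := b, 8 := 2 * int n + 4, 6 := Q, 7 := M)"
    using s(1,3-6) by (simp add: load_input_def fun_eq_iff Q_def M_def algebra_simps)
  have mem: "mem (block_result load_input s) = mem s"
    by (simp add: load_input_def)
  \<comment> \<open>A nonzero cell belongs to the input, and its residue is at most its address,
    hence below \<open>2 * n + 4\<close>.\<close>
  have zero: "mem s x = 0" if "2 * int n + 4 \<le> x mod M" for x
  proof (rule ccontr)
    assume "mem s x \<noteq> 0"
    then have x: "0 \<le> x" "x < 2 * int n + 4" using s(9) by auto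
    have "2 * int n + 4 < M + 1" using epoch_bound
      by (smt (verit) mult_nonneg_nonneg of_nat_0_le_iff)
    then have "x mod M \<le> x" using x zmod_le_nonneg_dividend by blast
    then show False using that x by simp
  qed
  have 1: "runs (block load_input) s (150 * L) (150 * L) (core (2 * int n + 4) False)"
    by (rule runs_weaken[OF runs_block[OF s(2) cost]])
      (use s(7,8) zero in \<open>auto simp: core_def regs mem\<close>)
  let ?P = "\<lambda>u. (0 < regs u 9 \<longleftrightarrow> solvable) \<and> bits (regs u 9) \<le> 2 * L \<and> finite_support u"
  have 2: "runs (Cond 4 (scale1_loop A) (block [Arith 9 Plus 5 1])) u (1 * L + ?T) ?D ?P"
    if u: "core (2 * int n + 4) False u" for u
  proof -
    have "runs (scale1_loop A) u ?T ?D ?P" if "0 < regs u 4"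
    proof -
      have t: "0 < t" using that u by (simp add: core_def)
      show ?thesis
        by (rule runs_weaken[OF runs_scale1_loop[OF t u order_refl epoch_bound]])
          (use exists_hit[OF t] L1 in \<open>auto simp: core_def\<close>)
    qed
    moreover have "runs (block [Arith 9 Plus 5 1]) u ?T ?D ?P" if "\<not> 0 < regs u 4"
    proof -
      have t: "t \<le> 0" using that u by (simp add: core_def)
      have "block_cost [Arith 9 Plus 5 1] u \<le> 3 * L"
        using u apply (simp add: core_def)
        by (rule order_trans, ((rule linear_bounds[OF L1] bits_params) | (simp; fail))+)
      moreover have "bits (b + 1) \<le> 2 * L"
        by (rule order_trans, ((rule linear_bounds[OF L1] bits_params) | (simp; fail))+)
      moreover have "3 * L \<le> loop_bound X" for X by (simp add: loop_bound_def)
      ultimately show ?thesis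
        using u solvable_nonpos[OF t]
        by (intro runs_weaken[OF runs_block, of u _ "3 * L"]) (auto simp: core_def)
    qed
    ultimately have "runs (Cond 4 (scale1_loop A) (block [Arith 9 Plus 5 1])) u (bits (regs u 4) + ?T) ?D ?P"
      by (rule runs_Cond)
    then show ?thesis
      by (rule runs_weaken) (use u bits_params(3) in \<open>auto simp: core_def\<close>)
  qed
  have 3: "runs (Cond 9 (Do (Const 0 1)) (Do (Const 0 0))) u (2 * L + 1) 1 (\<lambda>u. regs u 0 = of_bool solvable)"
    if u: "?P u" for u
  proof -
    have "runs (Cond 9 (Do (Const 0 1)) (Do (Const 0 0))) u (bits (regs u 9) + 1) 1
        (\<lambda>u. regs u 0 = of_bool solvable)"
      by (rule runs_Cond; rule runs_weaken[OF runs_Do, of u _ 1]) (use u in auto)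
    then show ?thesis by (rule runs_weaken) (use u in auto)
  qed
  show ?thesis unfolding knapsack_solver_def
    by (rule runs_weaken[OF runs_Seq[OF 1 runs_Seq[OF 2 3]]]) (use L1 in auto)
qed

lemma loop_bound_expand:
  "loop_bound (loop_bound (loop_bound (loop_bound X))) = (20 * L + 40 * Z * L) * (1 + Z + Z ^ 2 + Z ^ 3) + Z ^ 4 * X"
  by (simp add: loop_bound_def algebra_simps power2_eq_square power3_eq_cube power4_eq_xxxx)

end

section \<open>Absorbing polynomial overhead\<close>

lemma poly_nat_mono: "x \<le> y \<Longrightarrow> poly p x \<le> poly p y" for p :: "nat poly"
  by (induction p) (auto intro: mult_mono)

lemma length_le_sum_bits: "length xs \<le> (\<Sum>x\<leftarrow>xs. bits x)"
proof (induction xs)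
  case (Cons x xs)
  then show ?case using bits_pos[of x] by simp
qed simp

text \<open>Cells are also charged for their addresses, which are below the number of entries; this
  makes the bound quadratic.\<close>

lemma state_size_init:
  fixes xs :: "int list"
  defines "Z \<equiv> \<Sum>x\<leftarrow>xs. bits x"
  shows "state_size (init xs) \<le> Z * Z + Z"
proof -
  let ?m = "mem (init xs)"
  have "{a. ?m a \<noteq> 0} \<subseteq> int ` {..<length xs}"
    by (auto simp: init_def image_iff split: if_splits intro!: bexI[of _ "nat _"])
  then have "(\<Sum>a | ?m a \<noteq> 0. bits a + bits (?m a)) \<le> (\<Sum>a\<in>int ` {..<length xs}. bits a + bits (?m a))"
    by (intro sum_mono2) auto
  also have "\<dots> = (\<Sum>i<length xs. bits (int i) + bits (xs ! i))"
    by (subst sum.reindex) (auto simp: init_def)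
  also have "\<dots> \<le> (\<Sum>i<length xs. Z + bits (xs ! i))"
    using length_le_sum_bits[of xs]
    by (intro sum_mono add_right_mono) (auto simp: Z_def intro!: bits_le_bound)
  also have "\<dots> = length xs * Z + Z"
    by (simp add: sum.distrib Z_def sum_list_sum_nth lessThan_atLeast0)
  also have "\<dots> \<le> Z * Z + Z"
    using length_le_sum_bits[of xs] by (simp add: Z_def)
  finally show ?thesis by (simp add: state_size_def init_def)
qed

text \<open>With all weights equal to 1 there is an instance on \<open>n\<close> items whose size is linear in \<open>n\<close>.
  As every run takes some time and space, a function that bounds them up to a polynomial factor
  cannot be smaller than the inverse of a polynomial. Hence polynomial summands may be absorbed.\<close>

lemma trivial_instance:
  assumes A: "decides A subset_sum"
  obtains J \<tau> \<sigma> s where "J \<in> instances subset_sum" "ss_n J = n"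
    "input_size subset_sum J \<le> bits (int n) + n + 2"
    "exec A (init (encoding subset_sum J)) \<tau> \<sigma> s" "1 \<le> \<tau>" "1 \<le> \<sigma>"
proof -
  define J where "J = \<lparr>ss_n = n, ss_N = 1, ss_weight = (\<lambda>_. 1), ss_t = 0\<rparr>"
  have J: "J \<in> instances subset_sum" "ss_n J = n"
    by (auto simp: J_def subset_sum_def)
  have "(\<Sum>e\<leftarrow>[1..<Suc n]. bits 1) = n"
    by (simp add: sum_list_triv del: upt_Suc)
  then have size: "input_size subset_sum J \<le> bits (int n) + n + 2"
    by (simp add: input_size_def J_def subset_sum_def o_def del: upt_Suc)
  let ?s = "init (encoding subset_sum J)"
  obtain \<tau> \<sigma> s where ex: "exec A ?s \<tau> \<sigma> s"
    using A J(1) unfolding decides_def by blast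
  have m: "mem ?s 1 = 1" by (simp add: init_def J_def subset_sum_def del: upt_Suc)
  have "finite {a. mem ?s a \<noteq> 0}" using init_finite_support unfolding finite_support_def by blast
  then have "bits 1 + bits (mem ?s 1) \<le> (\<Sum>a | mem ?s a \<noteq> 0. bits a + bits (mem ?s a))"
    using m by (intro member_le_sum[of 1 _ "\<lambda>a. bits a + bits (mem ?s a)"]) auto
  then have "1 \<le> state_size ?s" by (simp add: state_size_def m)
  then have "1 \<le> \<sigma>" using exec_space_ge[OF ex] by simp
  then show thesis using that J size ex exec_time_pos[OF ex] by blast
qed

text \<open>An additive constant may be multiplied by \<open>P * f\<close>, as this is at least 1
  even if \<open>f\<close> is tiny.\<close>

lemma absorb_summand:
  fixes f :: real and a c x P :: nat
  assumes "x \<le> a + c * nat \<lfloor>P * f\<rfloor>" "1 \<le> P * f"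
  shows "real x \<le> real ((a + c) * P) * f"
proof -
  have "real x \<le> real (a + c * nat \<lfloor>P * f\<rfloor>)" using assms(1) by (simp only: of_nat_le_iff)
  also have "\<dots> \<le> real a * (P * f) + real c * (P * f)"
  proof -
    have "real a * 1 \<le> real a * (P * f)" using assms(2) by (intro mult_left_mono) auto
    moreover have "real (nat \<lfloor>P * f\<rfloor>) \<le> P * f" using assms(2) by (intro of_nat_floor) simp
    then have "real c * real (nat \<lfloor>P * f\<rfloor>) \<le> real c * (P * f)" by (intro mult_left_mono) auto
    ultimately show ?thesis by simp
  qed
  finally show ?thesis by (simp add: algebra_simps)
qed

text \<open>The terms free of \<open>TA\<close> and \<open>SA\<close> in both bounds: loop
  management, queries without their simulation, the 2 in \<open>3 * SA + 2\<close> (giving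
  \<open>400 * z ^ 5\<close>), the outer blocks, and the initial state
  (\<open>z * z + z\<close>).\<close>

definition overhead :: "nat \<Rightarrow> nat \<Rightarrow> nat" where
  "overhead R z = (20 * (20 * z) + 40 * z * (20 * z)) * (1 + z + z ^ 2 + z ^ 3)
     + z ^ 4 * (500 * (20 * z) * z + R) + 400 * z ^ 5 + 200 * (20 * z) + z * z + z"

lemma knapsack_solver_exec:
  fixes t s :: "nat \<Rightarrow> real" and pt ps :: "nat poly"
  assumes A: "decides A subset_sum"
    and pt: "\<forall>J\<in>instances subset_sum. \<forall>\<tau> \<sigma> u. exec A (init (encoding subset_sum J)) \<tau> \<sigma> u \<longrightarrow>
      real \<tau> \<le> real (poly pt (input_size subset_sum J)) * t (num_items subset_sum J)"
    and ps: "\<forall>J\<in>instances subset_sum. \<forall>\<tau> \<sigma> u. exec A (init (encoding subset_sum J)) \<tau> \<sigma> u \<longrightarrow>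
      real \<sigma> \<le> real (poly ps (input_size subset_sum J)) * s (num_items subset_sum J)"
    and I: "I \<in> instances knapsack"
  defines "z \<equiv> input_size knapsack I"
  shows "\<exists>\<tau> \<sigma> u. exec (knapsack_solver A) (init (encoding knapsack I)) \<tau> \<sigma> u \<and>
    regs u 0 = (if accepted knapsack I then 1 else 0) \<and>
    real \<tau> \<le> real ((overhead (written_below A) z + 600 * z ^ 5) * poly pt (2000 * z * z)) * t (num_items knapsack I) \<and>
    real \<sigma> \<le> real ((overhead (written_below A) z + 600 * z ^ 5) * poly ps (2000 * z * z)) * s (num_items knapsack I)"
proof -
  note pt = pt[rule_format] and ps = ps[rule_format]
  let ?n = "ks_n I" and ?N = "ks_N I"
  let ?xs = "encoding knapsack I" and ?y = "2000 * z * z"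
  have xs: "?xs = [int ?n, int ?N] @ map (\<lambda>e. int (ks_omega I e)) [1..<Suc ?n]
      @ map (\<lambda>e. int (ks_nu I e)) [1..<Suc ?n] @ [ks_t I, ks_b I]"
    by (simp add: knapsack_def)
  have z: "z = (\<Sum>x\<leftarrow>?xs. bits x)" by (simp add: z_def input_size_def)
  have len: "length ?xs = 2 * ?n + 4" by (simp add: xs del: upt_Suc)
  have mem_le: "bits x \<le> z" if "x \<in> set ?xs" for x
    unfolding z using that by (intro member_le_sum_list) auto
  have n4: "2 * ?n + 4 \<le> z" using length_le_sum_bits[of ?xs] len z by simp
  have small: "bits (int ?n) + ?n + 2 \<le> ?y"
  proof -
    have "bits (int ?n) + ?n + 2 \<le> 2 * z * 1" using mem_le[of "int ?n"] n4 by (simp add: xs)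
    also have "\<dots> \<le> 2 * z * (1000 * z)" using n4 by (intro mult_left_mono) auto
    finally show ?thesis by simp
  qed
  have items: "num_items subset_sum J = ss_n J" "num_items knapsack I = ?n" for J
    by (simp_all add: subset_sum_def knapsack_def)
  obtain J \<tau>0 \<sigma>0 u0 where J: "J \<in> instances subset_sum" "ss_n J = ?n"
    "input_size subset_sum J \<le> bits (int ?n) + ?n + 2"
    "exec A (init (encoding subset_sum J)) \<tau>0 \<sigma>0 u0" "1 \<le> \<tau>0" "1 \<le> \<sigma>0"
    by (rule trivial_instance[OF A, of ?n])
  \<comment> \<open>The sign of the bounding functions is not given; a run of positive time and
    space on \<open>n\<close> items forces it at \<open>n\<close>.\<close>
  have pos: "1 \<le> real (poly p ?y) * f" and f0: "0 \<le> f"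
    if "real x \<le> real (poly p (input_size subset_sum J)) * f" "1 \<le> x" for x p f
  proof -
    have 1: "1 \<le> real (poly p (input_size subset_sum J)) * f" using that by linarith
    then have "0 < real (poly p (input_size subset_sum J)) * f" by linarith
    then show f0: "0 \<le> f" by (simp add: zero_less_mult_iff)
    have "poly p (input_size subset_sum J) \<le> poly p ?y"
      using J(3) small by (intro poly_nat_mono) simp
    then have "real (poly p (input_size subset_sum J)) * f \<le> real (poly p ?y) * f"
      using f0 by (intro mult_right_mono) auto
    then show "1 \<le> real (poly p ?y) * f" using 1 by linarith
  qed
  note pt0 = pt[OF J(1,4), unfolded items J(2)] and ps0 = ps[OF J(1,4), unfolded items J(2)]
  note post = pos[OF pt0 J(5)] and t0 = f0[OF pt0 J(5)] and poss = pos[OF ps0 J(6)] and s0 = f0[OF ps0 J(6)]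
  define TA where "TA = nat \<lfloor>real (poly pt ?y) * t ?n\<rfloor>"
  define SA where "SA = nat \<lfloor>real (poly ps ?y) * s ?n\<rfloor>"
  have le_floor: "x \<le> nat \<lfloor>real (poly p ?y) * f\<rfloor>"
    if "real x \<le> real (poly p i) * f" "i \<le> ?y" "0 \<le> f" for x i f p
  proof -
    have "real (poly p i) * f \<le> real (poly p ?y) * f"
      using that(2,3) poly_nat_mono[of i ?y p] by (intro mult_right_mono) auto
    then show ?thesis using that(1) by (intro le_nat_floor) linarith
  qed
  interpret reduction A ?n ?N "ks_omega I" "ks_nu I" "ks_t I" "ks_b I" z TA SA
  proof
    show "ks_omega I e \<in> {1..?N}" "ks_nu I e \<in> {1..?N}" if "e \<in> {1..?n}" for e
      using I that by (simp_all add: knapsack_def image_subset_iff del: atLeastAtMost_iff)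
    show "\<tau> \<le> TA \<and> \<sigma> \<le> SA"
      if "J \<in> instances subset_sum" "ss_n J = ?n" "input_size subset_sum J \<le> ?y"
        "exec A (init (encoding subset_sum J)) \<tau> \<sigma> u" for J \<tau> \<sigma> u
      unfolding TA_def SA_def using that(2,3) t0 s0 pt[OF that(1,4)] ps[OF that(1,4)]
      by (auto simp: items intro!: le_floor)
  qed (use A n4 in \<open>auto simp: xs intro!: mem_le\<close>)
  have nth: "mem (init ?xs) (int i) = ?xs ! i" if "i < 2 * ?n + 4" for i
    using that len by (simp add: init_def)
  have "runs (knapsack_solver A) (init ?xs) (loop_bound (loop_bound (loop_bound (loop_bound TQ))) + 200 * L)
    (loop_bound (loop_bound (loop_bound (loop_bound DQ))) + 200 * L) (\<lambda>u. regs u 0 = of_bool solvable)"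
  proof (rule runs_knapsack_solver)
    show "mem (init ?xs) 0 = int ?n" "mem (init ?xs) 1 = int ?N"
      using nth[of 0] nth[of 1] by (simp_all add: xs)
    show "mem (init ?xs) (2 * int ?n + 2) = ks_t I"
      using nth[of "2 * ?n + 2"] by (simp add: xs nth_append algebra_simps del: upt_Suc)
    show "mem (init ?xs) (2 * int ?n + 3) = ks_b I"
      using nth[of "2 * ?n + 3"] by (simp add: xs nth_append algebra_simps numeral_3_eq_3 del: upt_Suc)
    show "mem (init ?xs) (int e + 1) = int (ks_omega I e)"
      "mem (init ?xs) (int e + 1 + int ?n) = int (ks_nu I e)" if "e \<in> {1..?n}" for e
    proof -
      define i where "i = e - 1"
      then have i: "e = Suc i" "i < ?n" using that by auto
      show "mem (init ?xs) (int e + 1) = int (ks_omega I e)"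
        using nth[of "e + 1"] i by (simp add: xs nth_append algebra_simps del: upt_Suc)
      show "mem (init ?xs) (int e + 1 + int ?n) = int (ks_nu I e)"
        using nth[of "e + 1 + ?n"] i by (simp add: xs nth_append algebra_simps del: upt_Suc)
    qed
    show "0 \<le> x \<and> x < 2 * int ?n + 4" if "mem (init ?xs) x \<noteq> 0" for x
      using that len by (auto simp: init_def split: if_splits)
  qed (simp_all add: init_def init_finite_support[unfolded init_def])
  then obtain \<tau> \<sigma> u where ex: "exec (knapsack_solver A) (init ?xs) \<tau> \<sigma> u"
    and \<tau>: "\<tau> \<le> loop_bound (loop_bound (loop_bound (loop_bound TQ))) + 200 * L"
    and \<sigma>: "\<sigma> \<le> state_size (init ?xs) + (loop_bound (loop_bound (loop_bound (loop_bound DQ))) + 200 * L)"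
    and u: "regs u 0 = of_bool solvable"
    unfolding runs_def by blast
  define a where "a = (20 * (20 * z) + 40 * z * (20 * z)) * (1 + z + z ^ 2 + z ^ 3)"
  define c where "c = z ^ 4 * (500 * (20 * z) * z + written_below A)"
  have ov: "overhead (written_below A) z = a + c + 400 * z ^ 5 + 200 * (20 * z) + z * z + z"
    by (simp only: overhead_def a_def c_def)
  \<comment> \<open>The four loops contribute \<open>z ^ 4\<close>, the cost of translating
    addresses another factor \<open>z\<close>.\<close>
  have split: "z ^ 4 * (500 * (20 * z) * z + written_below A + 10 * (20 * z) * X) = c + 200 * (z ^ 5 * X)" for X
  proof -
    have "z ^ 5 = z ^ 4 * z" using power_add[of z 4 1] by simp
    then have "z ^ 4 * (10 * (20 * z) * X) = 200 * (z ^ 5 * X)" by simp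
    then show ?thesis by (simp only: distrib_left c_def)
  qed
  have "loop_bound (loop_bound (loop_bound (loop_bound TQ))) = a + (c + 200 * (z ^ 5 * TA))"
    unfolding loop_bound_expand TQ_def L_def R_def split a_def ..
  then have "\<tau> \<le> overhead (written_below A) z + 600 * z ^ 5 * TA"
    using \<tau> unfolding ov L_def mult.assoc by linarith
  then have "\<tau> \<le> overhead (written_below A) z + 600 * z ^ 5 * nat \<lfloor>real (poly pt ?y) * t ?n\<rfloor>"
    by (simp add: TA_def)
  from absorb_summand[OF this post]
  have T: "real \<tau> \<le> real ((overhead (written_below A) z + 600 * z ^ 5) * poly pt ?y) * t ?n" .
  have "loop_bound (loop_bound (loop_bound (loop_bound DQ))) = a + (c + 200 * (z ^ 5 * (3 * SA + 2)))"
    unfolding loop_bound_expand DQ_def L_def R_def split a_def ..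
  moreover have "z ^ 5 * (3 * SA + 2) = 3 * (z ^ 5 * SA) + 2 * z ^ 5" by (simp add: distrib_left)
  ultimately have "\<sigma> \<le> overhead (written_below A) z + 600 * z ^ 5 * SA"
    using \<sigma> state_size_init[of ?xs, folded z] unfolding ov L_def mult.assoc by linarith
  then have "\<sigma> \<le> overhead (written_below A) z + 600 * z ^ 5 * nat \<lfloor>real (poly ps ?y) * s ?n\<rfloor>"
    by (simp add: SA_def)
  from absorb_summand[OF this poss]
  have S: "real \<sigma> \<le> real ((overhead (written_below A) z + 600 * z ^ 5) * poly ps ?y) * s ?n" .
  have "regs u 0 = (if accepted knapsack I then 1 else 0)"
    using u by (simp add: solvable_def knapsack_def)
  then show ?thesis unfolding items(2) using ex T S by blast
qed

theorem theorem2: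
  fixes t s :: "nat \<Rightarrow> real"
  assumes "\<exists>A. decides A subset_sum \<and> O_star_time A subset_sum t \<and> O_star_space A subset_sum s"
  shows "\<exists>B. decides B knapsack \<and> O_star_time B knapsack t \<and> O_star_space B knapsack s"
proof -
  obtain A pt ps where A: "decides A subset_sum"
    and pt: "\<forall>J\<in>instances subset_sum. \<forall>\<tau> \<sigma> u. exec A (init (encoding subset_sum J)) \<tau> \<sigma> u \<longrightarrow>
      real \<tau> \<le> real (poly pt (input_size subset_sum J)) * t (num_items subset_sum J)"
    and ps: "\<forall>J\<in>instances subset_sum. \<forall>\<tau> \<sigma> u. exec A (init (encoding subset_sum J)) \<tau> \<sigma> u \<longrightarrow>
      real \<sigma> \<le> real (poly ps (input_size subset_sum J)) * s (num_items subset_sum J)"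
    using assms unfolding O_star_time_def O_star_space_def by blast
  let ?B = "knapsack_solver A" and ?R = "written_below A"
  note B = knapsack_solver_exec[OF A pt ps]
  have poly: "\<exists>q :: nat poly. \<forall>z. poly q z = (overhead ?R z + 600 * z ^ 5) * poly p (2000 * z * z)" for p
  proof -
    let ?X = "[:0, 1:] :: nat poly"
    \<comment> \<open>This is \<open>overhead\<close> with the indeterminate for \<open>z\<close>;
      \<open>pcompose\<close> then inserts the size bound of the queries.\<close>
    let ?q = "(20 * (20 * ?X) + 40 * ?X * (20 * ?X)) * (1 + ?X + ?X ^ 2 + ?X ^ 3)
      + ?X ^ 4 * (500 * (20 * ?X) * ?X + [:?R:]) + 400 * ?X ^ 5 + 200 * (20 * ?X) + ?X * ?X + ?X"
    have "poly ((?q + 600 * ?X ^ 5) * pcompose p (2000 * ?X * ?X)) z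
        = (overhead ?R z + 600 * z ^ 5) * poly p (2000 * z * z)" for z
    proof -
      have "poly ?X z = z" "poly [:?R:] z = ?R" by simp_all
      then show ?thesis
        by (simp only: overhead_def poly_pcompose poly_add poly_mult poly_power poly_numeral poly_1)
    qed
    then show ?thesis by blast
  qed
  have "decides ?B knapsack" unfolding decides_def using B by blast
  moreover have "O_star_time ?B knapsack t" unfolding O_star_time_def
  proof -
    obtain q :: "nat poly" where q: "\<And>z. poly q z = (overhead ?R z + 600 * z ^ 5) * poly pt (2000 * z * z)"
      using poly by blast
    show "\<exists>p :: nat poly. \<forall>I\<in>instances knapsack. \<forall>\<tau> \<sigma> u. exec ?B (init (encoding knapsack I)) \<tau> \<sigma> u \<longrightarrow>
        real \<tau> \<le> real (poly p (input_size knapsack I)) * t (num_items knapsack I)"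
    proof (intro exI[of _ q] ballI allI impI)
      fix I \<tau> \<sigma> u
      assume I: "I \<in> instances knapsack" and ex: "exec ?B (init (encoding knapsack I)) \<tau> \<sigma> u"
      show "real \<tau> \<le> real (poly q (input_size knapsack I)) * t (num_items knapsack I)"
        \<comment> \<open>The bound is known for one run, and determinism makes it the only
          one.\<close>
        using B[OF I] exec_deterministic[OF ex] unfolding q by blast
    qed
  qed
  moreover have "O_star_space ?B knapsack s" unfolding O_star_space_def
  proof -
    obtain q :: "nat poly" where q: "\<And>z. poly q z = (overhead ?R z + 600 * z ^ 5) * poly ps (2000 * z * z)"
      using poly by blast
    show "\<exists>p :: nat poly. \<forall>I\<in>instances knapsack. \<forall>\<tau> \<sigma> u. exec ?B (init (encoding knapsack I)) \<tau> \<sigma> u \<longrightarrow>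
        real \<sigma> \<le> real (poly p (input_size knapsack I)) * s (num_items knapsack I)"
    proof (intro exI[of _ q] ballI allI impI)
      fix I \<tau> \<sigma> u
      assume I: "I \<in> instances knapsack" and ex: "exec ?B (init (encoding knapsack I)) \<tau> \<sigma> u"
      show "real \<sigma> \<le> real (poly q (input_size knapsack I)) * s (num_items knapsack I)"
        using B[OF I] exec_deterministic[OF ex] unfolding q by blast
    qed
  qed
  ultimately show ?thesis by blast
qed

end
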